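(* Let $\bar x$ be a local minimizer of the problem $\min_{x\in\mathbb{R}^n} f(x)$ subject to $F(x)\in\Omega$, and let $u\in\mathcal{C}(\bar x)$ be a critical direction. Let $M=(M_1,M_2)$ be a splitting of the constraint mapping $M(x)=F(x)-\Omega$ for the direction $u$, as described in the context. Then there exists $\lambda_0\ge 0$ such that $\Lambda^{\lambda_0}(\bar x;u)\neq\emptyset$ and, if $f$ and $F$ are twice Fréchet differentiable at $\bar x$, there exists some $\lambda\in\Lambda^{\lambda_0}(\bar x;u)$ with $$u^T\nabla_x^2\mathcal{L}(\bar x,\lambda_0,\lambda)u\ge 0.$$ If $M$ is metrically subregular in direction $u$ at $(\bar x,0)$, then these conditions hold with $\lambda_0=1$.
   Context: Data: $f:\mathbb{R}^n\to\mathbb{R}$ and $F:\mathbb{R}^n\to\mathbb{R}^m$ are continuously differentiable, and $\Omega=\bigcup_{i=1}^{\bar p}P_i\subset\mathbb{R}^m$ is a union of finitely many convex polyhedra. $\nabla f(x)$ (row vector) and $\nabla F(x)$ denote Jacobians, $\nabla^2$ second derivatives. For a closed set $C\subset\mathbb{R}^d$ and $z\in C$: $T(z;C)=\{w : \exists\, w_k\to w,\ t_k\downarrow 0,\ z+t_kw_k\in C\}$ (contingent cone); $\hat N(z;C)=\{\xi : \limsup_{z'\to z,\ z'\in C}\xi^T(z'-z)/\|z'-z\|\le 0\}$ (Fréchet normal cone); both are $\emptyset$ if $z\notin C$. For $z\in C$ and $w\in\mathbb{R}^d$ the Mordukhovich normal cone in direction $w$ is $N(z;C;w)=\{\xi :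 \exists\, t_k\downarrow 0,\ w_k\to w,\ \xi_k\to\xi,\ \xi_k\in\hat N(z+t_kw_k;C)\ \forall k\}$. Linearized cone: $T_{\rm lin}(\bar x)=\{u\in\mathbb{R}^n : \nabla F(\bar x)u\in T(F(\bar x);\Omega)\}$. Critical cone: $\mathcal{C}(\bar x)=\{u\in T_{\rm lin}(\bar x) : \nabla f(\bar x)u\le 0\}$. Directional metric subregularity: for $\rho,\delta>0$ let $V_{\rho,\delta}(u)=\{z : \|z\|\le\rho,\ \big\|\,\|u\|z-\|z\|u\,\big\|\le\delta\|z\|\|u\|\}$. A multifunction $S:\mathbb{R}^n\rightrightarrows\mathbb{R}^d$ is metrically subregular in direction $u$ at $(\bar x,\bar y)\in{\rm gph}\,S$ if there are $\rho,\delta,\kappa>0$ such that ${\rm d}(x,S^{-1}(\bar y))\le\kappa\,{\rm d}(\bar y,S(x))$ for all $x\in\bar x+V_{\rho,\delta}(u)$. Splitting (standing assumption): for each $u\in T_{\rm lin}(\bar x)$ the mapping $M(x)=F(x)-\Omega$ is split as $M=(M_1,M_2):\mathbb{R}^n\rightrightarrows\mathbb{R}^{m_1}\times\mathbb{R}^{m_2}$, $m=m_1+m_2$, $M_i(x)=F_i(x)-\Omega_i$, with $F=(F_1,F_2)$, $\Omega=\Omega_1\times\Omega_2$, each $F_i:\mathbb{R}^n\to\mathbb{R}^{m_i}$ continuously differentiable, each $\Omega_i$ a union of finitely many convex polyhedra, and $M_2$ metrically subregular in direction $u$ at $(\bar x,0)$. The splitting may depend on $u$; $m_2=0$ is allowed.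 Generalized Lagrangian: $\mathcal{L}(x,\lambda_0,\lambda)=\lambda_0f(x)+\lambda^TF(x)$. For $\lambda_0\ge 0$, $\Lambda^{\lambda_0}(\bar x;u)$ is the set of all $\lambda=(\lambda_1,\lambda_2)\in\mathbb{R}^{m_1}\times\mathbb{R}^{m_2}$ with $\lambda\in N(F(\bar x);\Omega;\nabla F(\bar x)u)$, $\nabla_x\mathcal{L}(\bar x,\lambda_0,\lambda)=0$ and $\lambda_0+\|\lambda_1\|\neq 0$. *)

theory Defs
  imports "HOL-Analysis.Analysis"
begin

section \<open>First and second derivatives\<close>

definition gradient :: "(real^'n \<Rightarrow> real) \<Rightarrow> real^'n \<Rightarrow> real^'n" where
  "gradient g x = (\<chi> i. frechet_derivative g (at x) (axis i 1))"

definition hessian :: "(real^'n \<Rightarrow> real) \<Rightarrow> real^'n \<Rightarrow> real^'n^'n" where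
  "hessian g x = jacobian (gradient g) (at x)"

definition cont_diff_real :: "(real^'n \<Rightarrow> real) \<Rightarrow> bool" where
  "cont_diff_real g \<longleftrightarrow> (\<forall>x. g differentiable (at x)) \<and> continuous_on UNIV (gradient g)"

definition cont_diff_vec :: "(real^'n \<Rightarrow> real^'m) \<Rightarrow> bool" where
  "cont_diff_vec G \<longleftrightarrow>
     (\<forall>x. G differentiable (at x)) \<and> continuous_on UNIV (\<lambda>x. jacobian G (at x))"

definition twice_diff_real_at :: "(real^'n \<Rightarrow> real) \<Rightarrow> real^'n \<Rightarrow> bool" where
  "twice_diff_real_at g x \<longleftrightarrow>
     (\<forall>\<^sub>F y in nhds x. g differentiable (at y)) \<and> gradient g differentiable (at x)"

definition twice_diff_vec_at :: "(real^'n \<Rightarrow> real^'m) \<Rightarrow> real^'n \<Rightarrow> bool" where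
  "twice_diff_vec_at G x \<longleftrightarrow>
     (\<forall>\<^sub>F y in nhds x. G differentiable (at y)) \<and>
     (\<lambda>y. jacobian G (at y)) differentiable (at x)"

section \<open>Tangent and normal cones\<close>

definition contingent_cone :: "'a::real_normed_vector \<Rightarrow> 'a set \<Rightarrow> 'a set" where
  "contingent_cone z C =
     {w. z \<in> C \<and> (\<exists>(t :: nat \<Rightarrow> real) v. (\<forall>k. 0 < t k) \<and> t \<longlonglongrightarrow> 0 \<and> v \<longlonglongrightarrow> w \<and>
                    (\<forall>k. z + t k *\<^sub>R v k \<in> C))}"

text \<open>At an isolated point of \<open>C\<close> the upper limit is that of the trivial filter, i.e.
  \<open>-\<infinity>\<close>, so that every vector is then a normal.\<close>

definition frechet_normal_cone :: "'a::real_inner \<Rightarrow> 'a set \<Rightarrow> 'a set" where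
  "frechet_normal_cone z C =
     {\<xi>. z \<in> C \<and> Limsup (at z within C) (\<lambda>y. ereal ((\<xi> \<bullet> (y - z)) / norm (y - z))) \<le> 0}"

definition dir_normal_cone :: "'a::real_inner \<Rightarrow> 'a set \<Rightarrow> 'a \<Rightarrow> 'a set" where
  "dir_normal_cone z C w =
     {\<xi>. z \<in> C \<and> (\<exists>(t :: nat \<Rightarrow> real) v \<eta>. (\<forall>k. 0 < t k) \<and> t \<longlonglongrightarrow> 0 \<and> v \<longlonglongrightarrow> w \<and> \<eta> \<longlonglongrightarrow> \<xi> \<and>
                    (\<forall>k. \<eta> k \<in> frechet_normal_cone (z + t k *\<^sub>R v k) C))}"

section \<open>Directional metric subregularity\<close>

definition dir_nbhd :: "real \<Rightarrow> real \<Rightarrow> 'a::real_normed_vector \<Rightarrow> 'a set" where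
  "dir_nbhd \<rho> \<delta> u =
     {z. norm z \<le> \<rho> \<and> norm (norm u *\<^sub>R z - norm z *\<^sub>R u) \<le> \<delta> * norm z * norm u}"

text \<open>The distance to the empty set is \<open>\<infinity>\<close>, whereas \<open>infdist\<close> returns \<open>0\<close> for it; hence the
  estimate is required only for nonempty \<open>S x\<close>. The set \<open>S\<^sup>-\<^sup>1(y\<^sub>0)\<close> always contains \<open>x\<^sub>0\<close>.\<close>

definition dir_metric_subregular ::
  "('a::real_normed_vector \<Rightarrow> 'b::real_normed_vector set) \<Rightarrow> 'a \<Rightarrow> 'a \<Rightarrow> 'b \<Rightarrow> bool" where
  "dir_metric_subregular S u x\<^sub>0 y\<^sub>0 \<longleftrightarrow>
     y\<^sub>0 \<in> S x\<^sub>0 \<and>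
     (\<exists>\<rho>>0. \<exists>\<delta>>0. \<exists>\<kappa>>0. \<forall>z\<in>dir_nbhd \<rho> \<delta> u.
        S (x\<^sub>0 + z) \<noteq> {} \<longrightarrow>
          infdist (x\<^sub>0 + z) {x. y\<^sub>0 \<in> S x} \<le> \<kappa> * infdist y\<^sub>0 (S (x\<^sub>0 + z)))"

section \<open>The optimization problem\<close>

definition finite_union_polyhedra :: "'a::euclidean_space set \<Rightarrow> bool" where
  "finite_union_polyhedra C \<longleftrightarrow> (\<exists>\<P>. finite \<P> \<and> (\<forall>P\<in>\<P>. polyhedron P) \<and> C = \<Union>\<P>)"

definition local_minimizer ::
  "('a::real_normed_vector \<Rightarrow> real) \<Rightarrow> ('a \<Rightarrow> 'b) \<Rightarrow> 'b set \<Rightarrow> 'a \<Rightarrow> bool" where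
  "local_minimizer f F \<Omega> x\<^sub>0 \<longleftrightarrow>
     F x\<^sub>0 \<in> \<Omega> \<and> (\<exists>\<epsilon>>0. \<forall>x\<in>ball x\<^sub>0 \<epsilon>. F x \<in> \<Omega> \<longrightarrow> f x\<^sub>0 \<le> f x)"

definition linearized_cone ::
  "(real^'n \<Rightarrow> real^'m) \<Rightarrow> (real^'m) set \<Rightarrow> real^'n \<Rightarrow> (real^'n) set" where
  "linearized_cone F \<Omega> x = {u. jacobian F (at x) *v u \<in> contingent_cone (F x) \<Omega>}"

definition critical_cone ::
  "(real^'n \<Rightarrow> real) \<Rightarrow> (real^'n \<Rightarrow> real^'m) \<Rightarrow> (real^'m) set \<Rightarrow> real^'n \<Rightarrow> (real^'n) set" where
  "critical_cone f F \<Omega> x = {u \<in> linearized_cone F \<Omega> x. gradient f x \<bullet> u \<le> 0}"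

definition constraint_map :: "('a \<Rightarrow> 'b::ab_group_add) \<Rightarrow> 'b set \<Rightarrow> 'a \<Rightarrow> 'b set" where
  "constraint_map G C x = {G x - y | y. y \<in> C}"

section \<open>Splittings\<close>

text \<open>A splitting of the \<open>m\<close> coordinates into blocks of sizes \<open>m\<^sub>1\<close> and \<open>m\<^sub>2\<close> is given by the
  set \<open>J\<close> of the indices of the first block; the second block is \<open>- J\<close>. Blocks may be empty,
  which a pair of index types would rule out. The space of the block \<open>J\<close> is identified
  isometrically with the subspace of the vectors vanishing outside \<open>J\<close>; the polyhedra of the
  block space are then exactly the polyhedra of the whole space that lie in this subspace.\<close>

definition block :: "'m set \<Rightarrow> real^'m \<Rightarrow> real^'m" where
  "block J y = (\<chi> i. if i \<in> J then y $ i else 0)"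

definition block_space :: "'m set \<Rightarrow> (real^'m) set" where
  "block_space J = {y. \<forall>i. i \<notin> J \<longrightarrow> y $ i = 0}"

text \<open>The block mappings \<open>F\<^sub>1\<close>, \<open>F\<^sub>2\<close> are \<open>block J \<circ> F\<close> and \<open>block (- J) \<circ> F\<close>; they are
  continuously differentiable whenever \<open>F\<close> is.\<close>

definition splitting ::
  "(real^'n \<Rightarrow> real^'m) \<Rightarrow> (real^'m) set \<Rightarrow> real^'n \<Rightarrow> real^'n \<Rightarrow>
     'm set \<Rightarrow> (real^'m) set \<Rightarrow> (real^'m) set \<Rightarrow> bool" where
  "splitting F \<Omega> x u J \<Omega>\<^sub>1 \<Omega>\<^sub>2 \<longleftrightarrow>
     \<Omega>\<^sub>1 \<subseteq> block_space J \<and> finite_union_polyhedra \<Omega>\<^sub>1 \<and>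
     \<Omega>\<^sub>2 \<subseteq> block_space (- J) \<and> finite_union_polyhedra \<Omega>\<^sub>2 \<and>
     \<Omega> = {y. block J y \<in> \<Omega>\<^sub>1 \<and> block (- J) y \<in> \<Omega>\<^sub>2} \<and>
     dir_metric_subregular (constraint_map (block (- J) \<circ> F) \<Omega>\<^sub>2) u x 0"

section \<open>Lagrangian and multipliers\<close>

definition lagrangian ::
  "(real^'n \<Rightarrow> real) \<Rightarrow> (real^'n \<Rightarrow> real^'m) \<Rightarrow> real^'n \<Rightarrow> real \<Rightarrow> real^'m \<Rightarrow> real" where
  "lagrangian f F x l\<^sub>0 l = l\<^sub>0 * f x + l \<bullet> F x"

definition multipliers ::
  "(real^'n \<Rightarrow> real) \<Rightarrow> (real^'n \<Rightarrow> real^'m) \<Rightarrow> (real^'m) set \<Rightarrow> 'm set \<Rightarrow> real \<Rightarrow>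
     real^'n \<Rightarrow> real^'n \<Rightarrow> (real^'m) set" where
  "multipliers f F \<Omega> J l\<^sub>0 x u =
     {l. l \<in> dir_normal_cone (F x) \<Omega> (jacobian F (at x) *v u) \<and>
         gradient (\<lambda>y. lagrangian f F y l\<^sub>0 l) x = 0 \<and>
         l\<^sub>0 + norm (block J l) \<noteq> 0}"

end

(* Near the point x, in the direction u, minimize a smoothed penalty function
     a * f(z) + C1 * soft(d1 z) + C2 * soft(d2 z),   d_i z = distance of F_i(z) to Omega_i,   soft r = sqrt (r^2 + s^2),
   plus a proximal term whose gradient is negligible. At a minimizer z with nearest point y in Omega, the derivative of
   the penalty is a proximal normal to Omega at y, so in the limit one obtains multipliers in the directional normal cone.
   If M is subregular in direction u, the penalty is exact, and a = 1 works with starting points x + t u. Otherwise take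
   a = 0 and start at points violating subregularity, moved into the constraint set of the second block; then the first
   multiplier block keeps norm at least 1/2.
   Second order: normals of a finite union of polyhedra are orthogonal to y - F x along a subsequence, hence the
   Lagrangian with the limit multiplier changes from x to z by a f(z) - a f(x) plus its pairing with F z - y.
   The latter is bounded below by C' |F z - y| - O(s) for C' < C1, C2, and exactness of the penalty with constant C'
   makes the change at least -o(t^2). *)

theory Submission
  imports Defs
begin

section \<open>Derivatives\<close>

text \<open>Smoothing is there because a minimizer of the penalty may be feasible, where r / |r| has
  no meaning, whereas r / soft r always defines a multiplier; with s = o(t^2) its cost is invisible
  at second order. The proximal term is there because the starting points are only nearly optimal:
  if their excess over a local lower bound is \<eta>, the minimizer in a ball of radius \<rho> stays
  within \<rho>/2, and the proximal gradient is at most 4 \<eta> / \<rho>. Hence \<rho> is chosen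
  like a geometric mean: large compared with \<eta>, small compared with the scale of the step, so
  that neither stationarity nor the direction u is disturbed in the limit. A gap between C' and C1,
  C2 has to exist because the second-order estimate concerns the limit multiplier and not that of
  the current minimizer; the gap absorbs their difference, paired with the residual. For a = 0
  exactness is trivial with C' = 0. The effort then goes into keeping the first residual at least s,
  and this is where subregularity of the second block enters.\<close>

lemma has_derivative_gradient:
  assumes "g differentiable (at x)"
  shows "(g has_derivative (\<lambda>h. gradient g x \<bullet> h)) (at x)"
proof -
  have D: "(g has_derivative frechet_derivative g (at x)) (at x)"
    using assms frechet_derivative_works by blast
  then interpret bounded_linear "frechet_derivative g (at x)"
    by (rule has_derivative_bounded_linear)
  have "frechet_derivative g (at x) h = gradient g x \<bullet> h" for h
  proof -
    have "frechet_derivative g (at x) h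
        = frechet_derivative g (at x) (\<Sum>i\<in>UNIV. h $ i *\<^sub>R axis i 1)"
      by (simp add: basis_expansion flip: scalar_mult_eq_scaleR)
    then show ?thesis
      by (simp add: sum scaleR gradient_def inner_vec_def mult.commute)
  qed
  then have "frechet_derivative g (at x) = (\<lambda>h. gradient g x \<bullet> h)" by blast
  then show ?thesis using D by metis
qed

lemma gradient_eqI:
  assumes "(g has_derivative (\<lambda>h. v \<bullet> h)) (at x)"
  shows "gradient g x = v"
  unfolding gradient_def frechet_derivative_at[OF assms, symmetric]
  by (simp add: vec_eq_iff inner_axis)

lemma gradient_lagrangian:
  assumes "f differentiable (at x)" "F differentiable (at x)"
  shows "gradient (\<lambda>y. lagrangian f F y l\<^sub>0 l) x
    = l\<^sub>0 *\<^sub>R gradient f x + l v* jacobian F (at x)"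
proof (rule gradient_eqI)
  have "(F has_derivative (\<lambda>h. jacobian F (at x) *v h)) (at x)"
    using assms(2) jacobian_works by blast
  from has_derivative_add[OF has_derivative_mult_right[OF has_derivative_gradient[OF assms(1)], of l\<^sub>0]
      has_derivative_inner_right[OF this, of l]]
  show "((\<lambda>y. lagrangian f F y l\<^sub>0 l) has_derivative
      (\<lambda>h. (l\<^sub>0 *\<^sub>R gradient f x + l v* jacobian F (at x)) \<bullet> h)) (at x)"
    by (simp add: lagrangian_def dot_lmul_matrix inner_add_left)
qed

text \<open>Frechet differentiability is uniform over bounded directions, so the difference
  quotients may follow moving directions: the error is a relative remainder tending to 0 times the
  bounded factor \<open>norm (v k)\<close>.\<close>

lemma hadamard_derivative:
  fixes F :: "'a::real_normed_vector \<Rightarrow> 'b::real_normed_vector"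
  assumes "(F has_derivative F') (at x)" "\<And>k. 0 < t k" "t \<longlonglongrightarrow> 0" "v \<longlonglongrightarrow> u"
  shows "(\<lambda>k. (F (x + t k *\<^sub>R v k) - F x) /\<^sub>R t k) \<longlonglongrightarrow> F' u"
proof -
  interpret bounded_linear F' using assms(1) by (rule has_derivative_bounded_linear)
  have lim: "(\<lambda>k. x + t k *\<^sub>R v k) \<longlonglongrightarrow> x"
    using tendsto_add[OF tendsto_const tendsto_scaleR[OF assms(3,4)]] by simp
  \<comment> \<open>The value 0 at the origin makes \<open>e\<close> continuous there, so that
    \<open>t k *\<^sub>R v k\<close> may vanish.\<close>
  define e where "e h = (if h = 0 then 0 else norm (F (x + h) - F x - F' h) / norm h)" for h
  have e0: "e 0 = 0" by (simp add: e_def)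
  have "(\<lambda>h. norm (F (x + h) - F x - F' h) / norm h) \<midarrow>0\<rightarrow> 0"
    using assms(1) unfolding has_derivative_at by blast
  then have "e \<midarrow>0\<rightarrow> e 0"
    unfolding LIM_def by (auto simp: e_def)
  then have "isCont e 0" by (simp only: isCont_def)
  then have "(\<lambda>k. e (t k *\<^sub>R v k)) \<longlonglongrightarrow> e 0"
    using tendsto_scaleR[OF assms(3,4)] by (intro isCont_tendsto_compose[of 0 e]) auto
  then have "(\<lambda>k. e (t k *\<^sub>R v k) * norm (v k)) \<longlonglongrightarrow> e 0 * norm u"
    by (rule tendsto_mult[OF _ tendsto_norm[OF assms(4)]])
  moreover have "norm ((F (x + t k *\<^sub>R v k) - F x) /\<^sub>R t k - F' (v k)) = e (t k *\<^sub>R v k) * norm (v k)" for k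
  proof -
    have "norm ((F (x + t k *\<^sub>R v k) - F x) /\<^sub>R t k - F' (v k))
       = norm ((F (x + t k *\<^sub>R v k) - F x - F' (t k *\<^sub>R v k)) /\<^sub>R t k)"
      using assms(2)[of k] by (simp add: scaleR algebra_simps)
    also have "\<dots> = e (t k *\<^sub>R v k) * norm (v k)"
    proof (cases "v k = 0")
      case True
      then show ?thesis by (simp add: zero)
    next
      case False
      then show ?thesis using assms(2)[of k]
        by (simp add: e_def divide_inverse abs_of_pos del: scaleR_right_diff_distrib)
    qed
    finally show ?thesis .
  qed
  ultimately have "(\<lambda>k. (F (x + t k *\<^sub>R v k) - F x) /\<^sub>R t k - F' (v k)) \<longlonglongrightarrow> 0"
    by - (rule tendsto_norm_zero_cancel, simp only: e0 mult_zero_left)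
  from tendsto_add[OF this tendsto[OF assms(4)]] show ?thesis by simp
qed

text \<open>The mean value theorem on the segment avoids the symmetry of the second derivative.\<close>

lemma second_order_limit:
  fixes g :: "real^'n \<Rightarrow> real"
  assumes diff: "\<And>y. g differentiable (at y)"
    and grad: "gradient g differentiable (at x)" "gradient g x = 0"
    and t: "\<And>k. 0 < t k" "t \<longlonglongrightarrow> 0" and v: "v \<longlonglongrightarrow> u"
  shows "(\<lambda>k. (g (x + t k *\<^sub>R v k) - g x) / (t k)\<^sup>2) \<longlonglongrightarrow> (u \<bullet> (hessian g x *v u)) / 2"
proof -
  define H where "H = hessian g x"
  have D: "(gradient g has_derivative (\<lambda>h. H *v h)) (at x)"
    using grad(1) jacobian_works unfolding H_def hessian_def by blast
  have "(\<lambda>k. (g (x + t k *\<^sub>R v k) - g x) / (t k)\<^sup>2 - (v k \<bullet> (H *v v k)) / 2) \<longlonglongrightarrow> 0"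
  proof -
    have ex: "\<exists>z. 0 < z \<and> z < 1 \<and> g (x + t k *\<^sub>R v k) - g x - (t k)\<^sup>2 * (v k \<bullet> (H *v v k)) / 2
       = t k * ((gradient g (x + z *\<^sub>R (t k *\<^sub>R v k)) - z *\<^sub>R t k *\<^sub>R (H *v v k)) \<bullet> v k)" for k
    proof -
      \<comment> \<open>Subtracting the quadratic model makes the mean value theorem produce the
        error of the linear model of the gradient at an intermediate point, which differentiability
        of the gradient at \<open>x\<close> controls.\<close>
      define \<phi> where "\<phi> z = g (x + z *\<^sub>R t k *\<^sub>R v k) - z\<^sup>2 * (t k)\<^sup>2 * (v k \<bullet> (H *v v k)) / 2" for z
      have "(\<phi> has_real_derivative gradient g (x + z *\<^sub>R t k *\<^sub>R v k) \<bullet> (t k *\<^sub>R v k)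
          - z * (t k)\<^sup>2 * (v k \<bullet> (H *v v k))) (at z)" for z
      proof -
        have "((\<lambda>z. x + z *\<^sub>R t k *\<^sub>R v k) has_derivative (\<lambda>h. h *\<^sub>R t k *\<^sub>R v k)) (at z)"
          by (auto intro!: derivative_eq_intros)
        from has_derivative_compose[OF this has_derivative_gradient[OF diff]]
        have "((\<lambda>z. g (x + z *\<^sub>R t k *\<^sub>R v k)) has_real_derivative
            gradient g (x + z *\<^sub>R t k *\<^sub>R v k) \<bullet> (t k *\<^sub>R v k)) (at z)"
          unfolding has_field_derivative_def by (rule has_derivative_eq_rhs) (auto simp: fun_eq_iff)
        moreover have "((\<lambda>z. z\<^sup>2 * (t k)\<^sup>2 * (v k \<bullet> (H *v v k)) / 2) has_real_derivative
            z * (t k)\<^sup>2 * (v k \<bullet> (H *v v k))) (at z)"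
          by (auto intro!: derivative_eq_intros)
        ultimately show ?thesis unfolding \<phi>_def by (rule DERIV_diff)
      qed
      from MVT2[OF zero_less_one this] obtain z where z: "0 < z" "z < 1" "\<phi> 1 - \<phi> 0 = (1 - 0) *
          (gradient g (x + z *\<^sub>R t k *\<^sub>R v k) \<bullet> (t k *\<^sub>R v k) - z * (t k)\<^sup>2 * (v k \<bullet> (H *v v k)))"
        by blast
      show ?thesis
      proof (intro exI[of _ z] conjI z(1,2))
        show "g (x + t k *\<^sub>R v k) - g x - (t k)\<^sup>2 * (v k \<bullet> (H *v v k)) / 2
          = t k * ((gradient g (x + z *\<^sub>R (t k *\<^sub>R v k)) - z *\<^sub>R t k *\<^sub>R (H *v v k)) \<bullet> v k)"
          using z(3) inner_commute[of "H *v v k" "v k"]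
          by (simp add: \<phi>_def inner_diff_left right_diff_distrib power2_eq_square mult_ac)
      qed
    qed
    define w where "w k z = (gradient g (x + z *\<^sub>R (t k *\<^sub>R v k)) - z *\<^sub>R t k *\<^sub>R (H *v v k))" for k z
    have "\<exists>z. \<forall>k. (0 < z k \<and> z k < 1) \<and> g (x + t k *\<^sub>R v k) - g x - (t k)\<^sup>2 * (v k \<bullet> (H *v v k)) / 2
       = t k * (w k (z k) \<bullet> v k)"
      by (rule choice) (use ex in \<open>simp only: w_def conj_assoc, blast\<close>)
    then obtain z where z: "\<And>k. 0 < z k \<and> z k < 1" "\<And>k. g (x + t k *\<^sub>R v k) - g x - (t k)\<^sup>2 * (v k \<bullet> (H *v v k)) / 2
       = t k * (w k (z k) \<bullet> v k)"
      by blast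
    \<comment> \<open>The intermediate points are \<open>x + tz k *\<^sub>R v k\<close>, again with
      steps tending to 0, so the Hadamard limit applies to the gradient.\<close>
    define tz where "tz k = z k * t k" for k
    have tz: "0 < tz k" for k using z(1) t(1) by (simp add: tz_def)
    have tz0: "tz \<longlonglongrightarrow> 0"
    proof (rule Lim_null_comparison[OF _ t(2)])
      show "\<forall>\<^sub>F k in sequentially. norm (tz k) \<le> t k"
        using z(1) t(1) by (auto simp: tz_def abs_mult less_imp_le intro!: mult_left_le_one_le always_eventually)
    qed
    have "(\<lambda>k. (gradient g (x + tz k *\<^sub>R v k) - gradient g x) /\<^sub>R tz k - H *v v k) \<longlonglongrightarrow> H *v u - H *v u"
      by (intro tendsto_diff hadamard_derivative[OF D tz tz0 v])
         (intro bounded_linear.tendsto[OF matrix_vector_mul_bounded_linear] v)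
    from tendsto_norm[OF this]
    have "(\<lambda>k. norm ((gradient g (x + tz k *\<^sub>R v k) - gradient g x) /\<^sub>R tz k - H *v v k)) \<longlonglongrightarrow> 0"
      by simp
    \<comment> \<open>The factor \<open>z k\<close> may fail to converge; it is enough that it stays
      in the unit interval.\<close>
    then have "(\<lambda>k. z k *\<^sub>R ((gradient g (x + tz k *\<^sub>R v k) - gradient g x) /\<^sub>R tz k - H *v v k)) \<longlonglongrightarrow> 0"
      by (rule Lim_null_comparison[rotated])
         (use z(1) in \<open>auto simp: less_imp_le intro!: mult_left_le_one_le always_eventually\<close>)
    from tendsto_inner[OF this v]
    have "(\<lambda>k. (z k *\<^sub>R ((gradient g (x + tz k *\<^sub>R v k) - gradient g x) /\<^sub>R tz k - H *v v k)) \<bullet> v k) \<longlonglongrightarrow> 0"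
      by simp
    moreover have "(z k *\<^sub>R ((gradient g (x + tz k *\<^sub>R v k) - gradient g x) /\<^sub>R tz k - H *v v k)) \<bullet> v k
       = (g (x + t k *\<^sub>R v k) - g x) / (t k)\<^sup>2 - (v k \<bullet> (H *v v k)) / 2" for k
    proof -
      have zk: "z k \<noteq> 0" "t k \<noteq> 0" using z(1)[of k] t(1)[of k] by auto
      have eq: "g (x + t k *\<^sub>R v k) - g x = t k * (w k (z k) \<bullet> v k) + (t k)\<^sup>2 * (v k \<bullet> (H *v v k)) / 2"
        using z(2)[of k] by linarith
      have "w k (z k) \<bullet> v k = gradient g (x + tz k *\<^sub>R v k) \<bullet> v k - z k * t k * ((H *v v k) \<bullet> v k)"
        by (simp add: w_def tz_def inner_diff_left)
      moreover have "(z k *\<^sub>R ((gradient g (x + tz k *\<^sub>R v k) - gradient g x) /\<^sub>R tz k - H *v v k)) \<bullet> v k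
          = z k * ((gradient g (x + tz k *\<^sub>R v k) \<bullet> v k) / (z k * t k) - (H *v v k) \<bullet> v k)"
        by (simp only: grad(2) tz_def inner_diff_left inner_scaleR_left diff_zero divide_inverse mult.commute)
      moreover have "z * (a / (z * t) - b) = (t * (a - z * t * b) + t\<^sup>2 * c / 2) / t\<^sup>2 - c / 2"
        if "z \<noteq> 0" "t \<noteq> 0" for a b c z t :: real
        using that by (simp add: field_simps power2_eq_square)
      ultimately show ?thesis unfolding eq using zk by metis
    qed
    ultimately show ?thesis by simp
  qed
  moreover have "(\<lambda>k. (v k \<bullet> (H *v v k)) / 2) \<longlonglongrightarrow> (u \<bullet> (H *v u)) / 2"
    by (intro tendsto_intros bounded_linear.tendsto[OF matrix_vector_mul_bounded_linear] v) simp
  ultimately show ?thesis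
    unfolding H_def[symmetric] by (rule Lim_transform[rotated])
qed

section \<open>Normals to unions of polyhedra and directional neighbourhoods\<close>

lemma lipschitz_near:
  fixes F :: "'a::real_normed_vector \<Rightarrow> 'b::real_normed_vector"
  assumes "\<And>y. y \<in> ball x r \<Longrightarrow> (F has_derivative F' y) (at y)"
    and "\<And>y. y \<in> ball x r \<Longrightarrow> onorm (F' y) \<le> B"
  shows "\<forall>y\<in>ball x r. \<forall>z\<in>ball x r. norm (F y - F z) \<le> B * norm (y - z)"
  using differentiable_bound[OF convex_ball, of x r F F' B] assms has_derivative_at_withinI by blast

lemma cont_diff_vec_lipschitz_near:
  fixes F :: "real^'n \<Rightarrow> real^'m"
  assumes "cont_diff_vec F"
  shows "\<exists>r>0. \<exists>B>0. \<forall>y\<in>ball x r. \<forall>z\<in>ball x r. norm (F y - F z) \<le> B * norm (y - z)"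
proof -
  have "isCont (\<lambda>y. jacobian F (at y)) x"
    using assms by (simp add: cont_diff_vec_def continuous_on_eq_continuous_at)
  then obtain r where r: "r > 0" "\<And>y. dist y x < r \<Longrightarrow> dist (jacobian F (at y)) (jacobian F (at x)) < 1"
    unfolding continuous_at_eps_delta using zero_less_one by blast
  define c where "c = norm (jacobian F (at x)) + 1"
  have "\<forall>y\<in>ball x r. \<forall>z\<in>ball x r. norm (F y - F z) \<le> real CARD('m) * real CARD('n) * c * norm (y - z)"
  proof (rule lipschitz_near[where F' = "\<lambda>y. (*v) (jacobian F (at y))"])
    fix y assume y: "y \<in> ball x r"
    show "(F has_derivative (*v) (jacobian F (at y))) (at y)"
      by (rule iffD1[OF jacobian_works]) (use assms in \<open>simp add: cont_diff_vec_def\<close>)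
    have "\<bar>jacobian F (at y) $ i $ j\<bar> \<le> c" for i j
    proof -
      have "\<bar>jacobian F (at y) $ i $ j\<bar> \<le> norm (jacobian F (at y))"
        by (rule order_trans[OF component_le_norm_cart Finite_Cartesian_Product.norm_nth_le])
      also have "\<dots> \<le> norm (jacobian F (at x)) + dist (jacobian F (at y)) (jacobian F (at x))"
        by (metis dist_norm norm_triangle_sub)
      also have "\<dots> \<le> c" using r(2)[of y] y by (simp add: c_def dist_commute)
      finally show ?thesis .
    qed
    then show "onorm ((*v) (jacobian F (at y))) \<le> real CARD('m) * real CARD('n) * c"
      by (rule onorm_le_matrix_component)
  qed
  moreover have "c > 0" by (simp add: c_def add_nonneg_pos)
  ultimately show ?thesis using r(1)
    by (intro exI[of _ r] conjI exI[of _ "real CARD('m) * real CARD('n) * c"]) simp_all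
qed

section \<open>Proximal normals and faces of polyhedra\<close>

lemma frechet_normal_cone_if_proximal:
  assumes "z \<in> C" "\<And>y. y \<in> C \<Longrightarrow> \<xi> \<bullet> (y - z) \<le> K * (norm (y - z))\<^sup>2"
  shows "\<xi> \<in> frechet_normal_cone z C"
proof -
  have *: "Limsup (at z within C) (\<lambda>y. ereal ((\<xi> \<bullet> (y - z)) / norm (y - z))) \<le> 0"
  \<comment> \<open>At an isolated point the filter is trivial and the upper limit is -\<infinity>.
    Otherwise dividing the quadratic bound by the norm leaves \<open>K * norm (y - z)\<close>, which
    tends to 0.\<close>
  proof (cases "at z within C = bot")
    case False
    have "((\<lambda>y. K * norm (y - z)) \<longlongrightarrow> K * norm (z - z)) (at z within C)"
      by (intro tendsto_intros)
    then have "((\<lambda>y. ereal (K * norm (y - z))) \<longlongrightarrow> 0) (at z within C)"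
      by (simp add: zero_ereal_def)
    then have "Limsup (at z within C) (\<lambda>y. ereal (K * norm (y - z))) = 0"
      using False by (rule lim_imp_Limsup[rotated])
    moreover have "Limsup (at z within C) (\<lambda>y. ereal ((\<xi> \<bullet> (y - z)) / norm (y - z)))
        \<le> Limsup (at z within C) (\<lambda>y. ereal (K * norm (y - z)))"
    proof (rule Limsup_mono)
      show "\<forall>\<^sub>F y in at z within C. ereal ((\<xi> \<bullet> (y - z)) / norm (y - z)) \<le> ereal (K * norm (y - z))"
        unfolding eventually_at_filter
        using assms(2) by (auto simp: divide_le_eq power2_eq_square mult.assoc)
    qed
    ultimately show ?thesis by simp
  qed simp
  then show ?thesis using assms(1) by (simp add: frechet_normal_cone_def)
qed

lemma finite_union_polyhedra_closed: "finite_union_polyhedra C \<Longrightarrow> closed C"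
  unfolding finite_union_polyhedra_def by (auto intro: polyhedron_imp_closed)

text \<open>After passing to a subsequence, all points lie in one polyhedron and have the same active
  inequalities there. Then \<open>y\<^sub>k + \<tau> (y\<^sub>l - y)\<close> remains in that polyhedron for small \<open>\<tau>\<close> of
  either sign, so that normals at \<open>y\<^sub>k\<close> are orthogonal to \<open>y\<^sub>l - y\<close>.\<close>

lemma proximal_normals_orthogonal_subseq:
  fixes C :: "'a::euclidean_space set"
  assumes C: "finite_union_polyhedra C" and y: "\<And>k::nat. Y k \<in> C" "Y \<longlonglongrightarrow> y"
    and prox: "\<And>k z. z \<in> C \<Longrightarrow> \<xi> k \<bullet> (z - Y k) \<le> K k * (norm (z - Y k))\<^sup>2"
  shows "\<exists>r::nat \<Rightarrow> nat. strict_mono r \<and> (\<forall>k l. \<xi> (r k) \<bullet> (Y (r l) - y) = 0)"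
proof -
  obtain \<P> where \<P>: "finite \<P>" "\<And>P. P \<in> \<P> \<Longrightarrow> polyhedron P" "C = \<Union>\<P>"
    using C unfolding finite_union_polyhedra_def by blast
  have "\<forall>P\<in>\<P>. \<exists>H. finite H \<and> P = \<Inter>H \<and> (\<forall>h\<in>H. \<exists>a b. a \<noteq> 0 \<and> h = {x. a \<bullet> x \<le> b})"
    using \<P>(2) unfolding polyhedron_def by blast
  then obtain H where H: "\<And>P. P \<in> \<P> \<Longrightarrow> finite (H P)" "\<And>P. P \<in> \<P> \<Longrightarrow> P = \<Inter>(H P)"
    "\<And>P h. P \<in> \<P> \<Longrightarrow> h \<in> H P \<Longrightarrow> \<exists>a b. a \<noteq> 0 \<and> h = {x. a \<bullet> x \<le> b}"
    by metis
  have "\<forall>h\<in>(\<Union>P\<in>\<P>. H P). \<exists>a b. h = {x. a \<bullet> x \<le> b}" using H(3) by blast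
  from bchoice[OF this] obtain a where "\<forall>h\<in>(\<Union>P\<in>\<P>. H P). \<exists>b. h = {x. a h \<bullet> x \<le> b}" by blast
  from bchoice[OF this] obtain b where "\<forall>h\<in>(\<Union>P\<in>\<P>. H P). h = {x. a h \<bullet> x \<le> b h}" by blast
  then have ab: "x \<in> h \<longleftrightarrow> a h \<bullet> x \<le> b h" if "P \<in> \<P>" "h \<in> H P" for P h x
    using that by blast
  have "\<exists>P. P \<in> \<P> \<and> Y k \<in> P" for k using y(1)[of k] \<P>(3) by blast
  then obtain Q where Q: "\<And>k. Q k \<in> \<P>" "\<And>k. Y k \<in> Q k" by metis
  \<comment> \<open>A type records a polyhedron containing \<open>Y k\<close> and its half-spaces
    active there. There are finitely many types, so one of them recurs infinitely often.\<close>
  define type where "type k = (Q k, {h \<in> H (Q k). a h \<bullet> Y k = b h})" for k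
  have "finite (Sigma \<P> (\<lambda>P. Pow (H P)))" using \<P>(1) H(1) by auto
  moreover have "range type \<subseteq> Sigma \<P> (\<lambda>P. Pow (H P))" using Q(1) by (auto simp: type_def)
  ultimately have "finite (range type)" by (rule finite_subset[rotated])
  then obtain k0 where "infinite {k. type k = type k0}"
    using pigeonhole_infinite[of UNIV type] by auto
  then obtain r :: "nat \<Rightarrow> nat" where r: "strict_mono r" "\<And>n. type (r n) = type k0"
    using infinite_enumerate by blast
  define P where "P = Q k0"
  define A where "A = {h \<in> H P. a h \<bullet> Y k0 = b h}"
  have P: "P \<in> \<P>" by (simp add: P_def Q)
  have rP: "Q (r n) = P" "{h \<in> H P. a h \<bullet> Y (r n) = b h} = A" for n
    using r(2)[of n] by (auto simp: type_def P_def A_def)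
  have lim: "(Y \<circ> r) \<longlonglongrightarrow> y" using y(2) r(1) by (rule LIMSEQ_subseq_LIMSEQ)
  have "\<xi> (r k) \<bullet> (Y (r l) - y) \<le> 0 \<and> \<xi> (r k) \<bullet> - (Y (r l) - y) \<le> 0" for k l
  proof -
    have "\<xi> (r k) \<bullet> v \<le> 0" if v: "v = Y (r l) - y \<or> v = - (Y (r l) - y)" for v
    proof -
      have "\<forall>\<^sub>F \<tau> in at_right 0. Y (r k) + \<tau> *\<^sub>R v \<in> h" if h: "h \<in> H P" for h
      proof (cases "h \<in> A")
        case True
        \<comment> \<open>Inequalities active along the whole subsequence stay active at the limit
          \<open>y\<close>, so \<open>v\<close> is parallel to their boundary hyperplanes.\<close>
        have act: "a h \<bullet> Y (r n) = b h" for n using True rP(2)[of n] by blast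
        have "(\<lambda>n. a h \<bullet> (Y \<circ> r) n) \<longlonglongrightarrow> a h \<bullet> y" by (intro tendsto_intros lim)
        then have "a h \<bullet> y = b h" using act by (simp add: LIMSEQ_const_iff)
        then have "a h \<bullet> v = 0" using v act[of l] by (auto simp: inner_diff_right)
        then have "Y (r k) + \<tau> *\<^sub>R v \<in> h" for \<tau>
          by (simp add: ab[OF P h] act inner_add_right)
        then show ?thesis by simp
      next
        case False
        have "Y (r k) \<in> \<Inter>(H P)" using Q(2)[of "r k"] unfolding rP(1) H(2)[OF P, symmetric] .
        then have "Y (r k) \<in> h" using h by blast
        then have "a h \<bullet> Y (r k) < b h" using False rP(2)[of k] h ab[OF P h] by (simp add: order.strict_iff_order) blast
        moreover have "((\<lambda>\<tau>. a h \<bullet> (Y (r k) + \<tau> *\<^sub>R v)) \<longlongrightarrow> a h \<bullet> (Y (r k) + 0 *\<^sub>R v)) (at_right 0)"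
          by (intro tendsto_intros)
        ultimately have "\<forall>\<^sub>F \<tau> in at_right 0. a h \<bullet> (Y (r k) + \<tau> *\<^sub>R v) < b h"
          by (simp add: order_tendstoD(2))
        then show ?thesis by (rule eventually_mono) (simp add: ab[OF P h])
      qed
      then have "\<forall>\<^sub>F \<tau> in at_right 0. \<forall>h\<in>H P. Y (r k) + \<tau> *\<^sub>R v \<in> h"
        using H(1)[OF P] by (simp add: eventually_ball_finite)
      then have "\<forall>\<^sub>F \<tau> in at_right 0. Y (r k) + \<tau> *\<^sub>R v \<in> C"
      proof (rule eventually_mono)
        fix \<tau> assume "\<forall>h\<in>H P. Y (r k) + \<tau> *\<^sub>R v \<in> h"
        then have "Y (r k) + \<tau> *\<^sub>R v \<in> P" by (subst H(2)[OF P]) blast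
        then show "Y (r k) + \<tau> *\<^sub>R v \<in> C" using \<P>(3) P by blast
      qed
      moreover have "\<forall>\<^sub>F \<tau> in at_right (0::real). 0 < \<tau>" by (rule eventually_at_right_less)
      \<comment> \<open>The proximal bound is quadratic in \<open>\<tau>\<close>, so after division
        by \<open>\<tau>\<close> its right-hand side still vanishes in the limit.\<close>
      ultimately have "\<forall>\<^sub>F \<tau> in at_right 0. \<xi> (r k) \<bullet> v \<le> K (r k) * (\<tau> * (norm v)\<^sup>2)"
      proof eventually_elim
        case (elim \<tau>)
        then have "\<xi> (r k) \<bullet> (\<tau> *\<^sub>R v) \<le> K (r k) * (norm (\<tau> *\<^sub>R v))\<^sup>2"
          using prox[of "Y (r k) + \<tau> *\<^sub>R v" "r k"] by (simp only: add_diff_cancel_left')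
        moreover have "K (r k) * (norm (\<tau> *\<^sub>R v))\<^sup>2 = \<tau> * (K (r k) * (\<tau> * (norm v)\<^sup>2))"
          by (simp add: power2_eq_square)
        ultimately have "\<tau> * (\<xi> (r k) \<bullet> v) \<le> \<tau> * (K (r k) * (\<tau> * (norm v)\<^sup>2))"
          by (simp only: inner_scaleR_right)
        then show ?case using elim(2) by (simp only: mult_le_cancel_left_pos)
      qed
      moreover have "((\<lambda>\<tau>. K (r k) * (\<tau> * (norm v)\<^sup>2)) \<longlongrightarrow> K (r k) * (0 * (norm v)\<^sup>2)) (at_right 0)"
        by (intro tendsto_intros)
      ultimately show ?thesis
        using tendsto_lowerbound[OF _ _ trivial_limit_at_right_real] by (metis mult_zero_left mult_zero_right)
    qed
    then show ?thesis by blast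
  qed
  then show ?thesis using r(1)
    by (intro exI[of _ r] conjI allI antisym) (auto simp: inner_diff_right)
qed

section \<open>Subregularity as a distance estimate, and directional neighbourhoods\<close>

lemma infdist_constraint_map:
  fixes G :: "'a \<Rightarrow> 'b::real_normed_vector"
  shows "infdist 0 (constraint_map G C x) = infdist (G x) C"
proof (cases "C = {}")
  case False
  have eq: "constraint_map G C x = (\<lambda>y. G x - y) ` C" by (auto simp: constraint_map_def)
  show ?thesis using False unfolding eq by (simp add: infdist_notempty image_image dist_norm[of 0] dist_norm[of "G x"])
qed (simp add: constraint_map_def infdist_def)

lemma zero_in_constraint_map: "0 \<in> constraint_map G C x \<longleftrightarrow> G x \<in> C"
  by (auto simp: constraint_map_def)

text \<open>Feasibility of \<open>x\<close> makes \<open>C\<close> nonempty, hence all values of the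
  constraint map are nonempty and the guard in the definition always holds; the residual then bounds
  the distance to the solution set.\<close>

lemma dir_metric_subregular_constraint_map:
  fixes G :: "'a::real_normed_vector \<Rightarrow> 'b::real_normed_vector"
  assumes "x \<in> A" "A = {x. G x \<in> C}"
  shows "dir_metric_subregular (constraint_map G C) u x 0 \<longleftrightarrow>
    (\<exists>\<rho>>0. \<exists>\<delta>>0. \<exists>\<kappa>>0. \<forall>z\<in>dir_nbhd \<rho> \<delta> u. infdist (x + z) A \<le> \<kappa> * infdist (G (x + z)) C)"
proof -
  have "constraint_map G C y \<noteq> {}" for y using assms by (auto simp: constraint_map_def)
  then show ?thesis
    using assms by (simp add: dir_metric_subregular_def zero_in_constraint_map infdist_constraint_map)
qed

lemma dir_nbhd_mono: "\<rho> \<le> \<rho>' \<Longrightarrow> \<delta> \<le> \<delta>' \<Longrightarrow> dir_nbhd \<rho> \<delta> u \<subseteq> dir_nbhd \<rho>' \<delta>' u"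
  unfolding dir_nbhd_def
  by (auto intro: order_trans[OF _ mult_right_mono[OF mult_right_mono]])

text \<open>Apart from the bound on the norm, membership is invariant under positive scaling, so a
  perturbation \<open>h\<close> of \<open>u\<close> can be treated uniformly in
  \<open>t\<close>.\<close>

lemma dir_nbhd_contains:
  fixes u :: "'a::real_normed_vector"
  assumes "\<rho> > 0" "\<delta> > 0"
  shows "\<exists>\<epsilon>>0. \<forall>t h. 0 < t \<and> t \<le> \<epsilon> \<and> norm h \<le> \<epsilon> \<longrightarrow> t *\<^sub>R (u + h) \<in> dir_nbhd \<rho> \<delta> u"
proof -
  \<comment> \<open>\<open>\<epsilon>\<^sub>1\<close> keeps \<open>norm (u + h)\<close> at least
    half of \<open>norm u\<close>. The angular error is at most twice
    \<open>norm h * norm u\<close>; these two factors 2 give the quarter in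
    \<open>\<epsilon>\<^sub>2\<close>. For \<open>u = 0\<close> the angular condition is
    trivial.\<close>
  define \<epsilon>\<^sub>1 \<epsilon>\<^sub>2 where \<epsilon>12_def: "\<epsilon>\<^sub>1 = (if u = 0 then 1 else norm u / 2)" "\<epsilon>\<^sub>2 = (if u = 0 then 1 else \<delta> * norm u / 4)"
  define \<epsilon> where "\<epsilon> = min (min 1 (\<rho> / (norm u + 1))) (min \<epsilon>\<^sub>1 \<epsilon>\<^sub>2)"
  have "\<epsilon> \<le> \<epsilon>\<^sub>1" "\<epsilon> \<le> \<epsilon>\<^sub>2" by (simp_all add: \<epsilon>_def)
  then  have \<epsilon>: "\<epsilon> \<le> 1" "\<epsilon> \<le> \<rho> / (norm u + 1)" "u \<noteq> 0 \<Longrightarrow> \<epsilon> \<le> norm u / 2" "u \<noteq> 0 \<Longrightarrow> \<epsilon> \<le> \<delta> * norm u / 4"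
    by (simp_all add: \<epsilon>_def \<epsilon>12_def)
  have pos: "\<epsilon> > 0" using assms by (simp add: \<epsilon>_def \<epsilon>12_def add_nonneg_pos)
  have "t *\<^sub>R (u + h) \<in> dir_nbhd \<rho> \<delta> u" if t: "0 < t" "t \<le> \<epsilon>" and h: "norm h \<le> \<epsilon>" for t h
  proof -
    have n: "norm (u + h) \<le> norm u + 1" using h \<epsilon>(1) norm_triangle_ineq[of u h] by linarith
    have "t * norm (u + h) \<le> \<rho> / (norm u + 1) * (norm u + 1)"
      using t \<epsilon>(2) assms n by (intro mult_mono) auto
    also have "\<dots> = \<rho>" by (simp add: add_nonneg_eq_0_iff)
    finally have 1: "norm (t *\<^sub>R (u + h)) \<le> \<rho>" using t(1) by simp
    have "norm (norm u *\<^sub>R (u + h) - norm (u + h) *\<^sub>R u) \<le> \<delta> * norm (u + h) * norm u"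
    proof (cases "u = 0")
      case False
      have l: "norm u / 2 \<le> norm (u + h)"
        using h \<epsilon>(3)[OF False] norm_triangle_ineq2[of u "- h"] by simp
      have "norm u *\<^sub>R (u + h) - norm (u + h) *\<^sub>R u = norm u *\<^sub>R h + (norm u - norm (u + h)) *\<^sub>R u"
        by (simp add: algebra_simps)
      also have "norm \<dots> \<le> norm u * norm h + \<bar>norm u - norm (u + h)\<bar> * norm u"
        using norm_triangle_ineq by (metis abs_norm_cancel norm_scaleR)
      also have "\<dots> \<le> norm u * norm h + norm h * norm u"
        using norm_triangle_ineq3[of u "u + h"] by (intro add_left_mono mult_right_mono) auto
      also have "\<dots> = (2 * norm h) * norm u" by simp
      also have "\<dots> \<le> (\<delta> * (norm u / 2)) * norm u"
        using h \<epsilon>(4)[OF False] by (intro mult_right_mono) auto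
      also have "\<dots> \<le> \<delta> * norm (u + h) * norm u"
        using l assms by (intro mult_right_mono mult_left_mono) auto
      finally show ?thesis .
    qed simp
    from mult_left_mono[OF this, of t]
    have "norm (norm u *\<^sub>R t *\<^sub>R (u + h) - norm (t *\<^sub>R (u + h)) *\<^sub>R u) \<le> \<delta> * norm (t *\<^sub>R (u + h)) * norm u"
    proof -
      assume A: "0 \<le> t \<Longrightarrow> t * norm (norm u *\<^sub>R (u + h) - norm (u + h) *\<^sub>R u) \<le> t * (\<delta> * norm (u + h) * norm u)"
      have "norm u *\<^sub>R t *\<^sub>R (u + h) - norm (t *\<^sub>R (u + h)) *\<^sub>R u = t *\<^sub>R (norm u *\<^sub>R (u + h) - norm (u + h) *\<^sub>R u)"
        using t(1) by (simp add: scaleR_diff_right mult.commute)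
      then show ?thesis using A t(1) by (simp add: mult_ac)
    qed
    with 1 show ?thesis by (simp add: dir_nbhd_def)
  qed
  with pos show ?thesis by blast
qed

text \<open>For \<open>u = 0\<close> the scaling \<open>t\<close> is not determined by \<open>z\<close>; any \<open>t\<close> with \<open>z = o(t)\<close> will do.\<close>

lemma dir_nbhd_sequence:
  fixes u :: "'a::real_normed_vector"
  assumes z: "\<And>k. z k \<in> dir_nbhd (1 / real (Suc k)) (1 / real (Suc k)) u" "\<And>k. z k \<noteq> 0"
  shows "\<exists>t::nat \<Rightarrow> real. (\<forall>k. 0 < t k) \<and> t \<longlonglongrightarrow> 0 \<and> (\<lambda>k. z k /\<^sub>R t k) \<longlonglongrightarrow> u"
proof -
  have n0: "(\<lambda>k. norm (z k)) \<longlonglongrightarrow> 0"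
    by (rule Lim_null_comparison[OF _ lim_inverse_n'[THEN LIMSEQ_Suc]])
       (use z(1) in \<open>auto simp: dir_nbhd_def intro!: always_eventually\<close>)
  show ?thesis
  proof (cases "u = 0")
    case True
    \<comment> \<open>The square root gives \<open>z k /\<^sub>R t k\<close> the norm
      \<open>t k\<close>, so it tends to the required direction 0.\<close>
    define t where "t k = sqrt (norm (z k))" for k
    have "t \<longlonglongrightarrow> sqrt 0" unfolding t_def by (intro tendsto_intros n0)
    then have t0: "t \<longlonglongrightarrow> 0" by simp
    moreover have tp: "t k > 0" for k using z(2) by (simp add: t_def)
    moreover have "norm (z k /\<^sub>R t k) = t k" for k
    proof -
      have "norm (z k) = t k * t k" by (simp add: t_def)
      then show ?thesis using tp[of k] by simp
    qed
    then have "(\<lambda>k. z k /\<^sub>R t k) \<longlonglongrightarrow> 0"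
      using t0 by - (rule tendsto_norm_zero_cancel, simp)
    ultimately show ?thesis using True by blast
  next
    case False
    \<comment> \<open>With this normalization the distance from \<open>z k /\<^sub>R t k\<close> to
      \<open>u\<close> is the angular defect from the definition of the neighbourhood, divided by
      \<open>norm (z k)\<close>.\<close>
    define t where "t k = norm (z k) / norm u" for k
    have tp: "t k > 0" for k using z(2) False by (simp add: t_def)
    have "t \<longlonglongrightarrow> 0 / norm u" unfolding t_def by (intro tendsto_intros n0) (use False in simp)
    then have t0: "t \<longlonglongrightarrow> 0" by simp
    have "norm (z k /\<^sub>R t k - u) \<le> 1 / real (Suc k) * norm u" for k
    proof -
      have "z k /\<^sub>R t k - u = (norm u *\<^sub>R z k - norm (z k) *\<^sub>R u) /\<^sub>R norm (z k)"
        using z(2)[of k] by (simp add: t_def scaleR_diff_right divide_inverse mult.commute)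
      then have "norm (z k /\<^sub>R t k - u) = norm (norm u *\<^sub>R z k - norm (z k) *\<^sub>R u) / norm (z k)"
        by (simp add: divide_inverse_commute)
      also have "\<dots> \<le> (1 / real (Suc k) * norm (z k) * norm u) / norm (z k)"
        using z(1)[of k] by (intro divide_right_mono) (auto simp: dir_nbhd_def)
      finally show ?thesis using z(2)[of k] by simp
    qed
    moreover have "(\<lambda>k. 1 / real (Suc k) * norm u) \<longlonglongrightarrow> 0"
      using tendsto_mult_left_zero[OF lim_inverse_n'[THEN LIMSEQ_Suc]] .
    ultimately have "(\<lambda>k. z k /\<^sub>R t k - u) \<longlonglongrightarrow> 0"
      by - (rule Lim_null_comparison[of _ "\<lambda>k. 1 / real (Suc k) * norm u"], auto)
    then have "(\<lambda>k. z k /\<^sub>R t k) \<longlonglongrightarrow> u" by (rule LIM_zero_cancel)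
    with tp t0 show ?thesis by blast
  qed
qed

section \<open>Smoothed penalties\<close>

text \<open>For \<open>s > 0\<close> the composition with the norm is differentiable even at zero
  residual; for nonnegative arguments the value lies between \<open>r\<close> and
  \<open>r + s\<close>.\<close>

definition soft_abs :: "real \<Rightarrow> real \<Rightarrow> real" where
  "soft_abs s r = sqrt (r\<^sup>2 + s\<^sup>2)"

lemma soft_abs_pos: "0 < s \<Longrightarrow> 0 < soft_abs s r"
  by (simp add: soft_abs_def add_nonneg_pos)

lemma soft_abs_ge: "r \<le> soft_abs s r"
  unfolding soft_abs_def by (rule real_le_rsqrt) simp

lemma soft_abs_le: "0 \<le> r \<Longrightarrow> 0 \<le> s \<Longrightarrow> soft_abs s r \<le> r + s"
  unfolding soft_abs_def by (rule real_le_lsqrt) (auto simp: power2_sum)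

text \<open>Monotonicity in \<open>r\<close>, then the triangle inequality in the plane for the
  vectors (r', s) and (d, 0).\<close>

lemma soft_abs_mono:
  assumes "0 \<le> r" "0 \<le> d" "r \<le> r' + d"
  shows "soft_abs s r \<le> soft_abs s r' + d"
proof -
  have "soft_abs s r \<le> soft_abs s (r' + d)"
    unfolding soft_abs_def using assms by (intro real_sqrt_le_mono add_right_mono power_mono)
  also have "\<dots> \<le> soft_abs s r' + d"
    using real_sqrt_sum_squares_triangle_ineq[of r' d s 0] assms(2) by (simp add: soft_abs_def)
  finally show ?thesis .
qed

text \<open>The quotient is the pairing of a unit-weight penalty normal with its residual, so
  smoothing costs at most \<open>s\<close> in this pairing. For \<open>r > s\<close> the reason is
  (r - s) (r + s) \<le> r^2.\<close>

lemma soft_abs_quotient_ge: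
  assumes "0 \<le> r" "0 < s"
  shows "r - s \<le> r\<^sup>2 / soft_abs s r"
proof -
  have "(r - s) * soft_abs s r \<le> r\<^sup>2"
  proof (cases "r \<le> s")
    case True
    then have "(r - s) * soft_abs s r \<le> 0"
      using soft_abs_pos[OF assms(2), of r] by (simp add: mult_nonpos_nonneg less_imp_le)
    then show ?thesis using zero_le_power2[of r] by linarith
  next
    case False
    then have "(r - s) * soft_abs s r \<le> (r - s) * (r + s)"
      using soft_abs_le[of r s] assms by (intro mult_left_mono) auto
    also have "\<dots> \<le> r\<^sup>2" by (simp add: algebra_simps power2_eq_square)
    finally show ?thesis .
  qed
  then show ?thesis using soft_abs_pos[OF assms(2), of r] by (simp add: le_divide_eq)
qed

text \<open>Here \<open>m\<close> stands for a limit multiplier close to the penalty normal of the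
  residual \<open>r\<close>. Replacing one by the other costs at most
  \<open>(C - C') * norm r\<close>, and smoothing costs \<open>C * s\<close>.\<close>

lemma soft_abs_inner_ge:
  fixes m r :: "'a::real_inner"
  assumes "0 < s" "0 \<le> C" "norm (m - (C / soft_abs s (norm r)) *\<^sub>R r) \<le> C - C'"
  shows "C' * norm r - C * s \<le> m \<bullet> r"
proof -
  define \<mu> where "\<mu> = (C / soft_abs s (norm r)) *\<^sub>R r"
  have "C * (norm r - s) \<le> C * ((norm r)\<^sup>2 / soft_abs s (norm r))"
    using soft_abs_quotient_ge[OF norm_ge_zero assms(1)] assms(2) by (rule mult_left_mono)
  also have "\<dots> = \<mu> \<bullet> r" by (simp add: \<mu>_def dot_square_norm)
  finally have 1: "C * (norm r - s) \<le> \<mu> \<bullet> r" .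
  have "- ((m - \<mu>) \<bullet> r) \<le> norm (m - \<mu>) * norm r"
    using Cauchy_Schwarz_ineq2[of "m - \<mu>" r] by linarith
  also have "\<dots> \<le> (C - C') * norm r"
    using assms(3) by (intro mult_right_mono) (simp_all add: \<mu>_def)
  finally show ?thesis using 1 by (simp add: inner_diff_left algebra_simps)
qed

section \<open>Coordinate blocks\<close>

lemma block_add: "block J (y + z) = block J y + block J z"
  and block_diff: "block J (y - z) = block J y - block J z"
  and block_scaleR: "block J (c *\<^sub>R y) = c *\<^sub>R block J y"
  and block_complement: "block J y + block (- J) y = y"
  and block_block: "block J (block J y) = block J y"
  and block_block_complement: "block J (block (- J) y) = 0" "block (- J) (block J y) = 0"
  by (auto simp: block_def vec_eq_iff)

lemma block_id: "y \<in> block_space J \<Longrightarrow> block J y = y"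
  and block_zero: "y \<in> block_space J \<Longrightarrow> block (- J) y = 0"
  and block_zero': "y \<in> block_space (- J) \<Longrightarrow> block J y = 0"
  by (auto simp: block_def block_space_def vec_eq_iff)

lemma inner_block: "block J y \<bullet> z = block J y \<bullet> block J z"
  by (auto simp: block_def inner_vec_def intro!: sum.cong)

lemma norm_block_le: "norm (block J y) \<le> norm y"
  by (rule norm_le_componentwise_cart) (simp add: block_def)

lemma bounded_linear_block: "bounded_linear (block J)"
  by (rule bounded_linear_intro[where K = 1]) (simp_all add: block_add block_scaleR norm_block_le)

lemma infdist_block_le:
  assumes "\<And>y. y \<in> \<Omega> \<Longrightarrow> block J y \<in> \<Omega>\<^sub>1" "\<Omega> \<noteq> {}"
  shows "infdist (block J v) \<Omega>\<^sub>1 \<le> infdist v \<Omega>"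
  unfolding infdist_notempty[OF assms(2)]
proof (rule cINF_greatest[OF assms(2)])
  fix y assume "y \<in> \<Omega>"
  then have "infdist (block J v) \<Omega>\<^sub>1 \<le> dist (block J v) (block J y)"
    using assms(1) by (intro infdist_le)
  also have "\<dots> \<le> dist v y" by (simp add: dist_norm norm_block_le flip: block_diff)
  finally show "infdist (block J v) \<Omega>\<^sub>1 \<le> dist v y" .
qed

section \<open>The penalty and its proximal normals\<close>

definition penalty ::
  "'m set \<Rightarrow> (real^'m) set \<Rightarrow> (real^'m) set \<Rightarrow> real \<Rightarrow> real \<Rightarrow> real \<Rightarrow> real^'m \<Rightarrow> real" where
  "penalty J \<Omega>\<^sub>1 \<Omega>\<^sub>2 C\<^sub>1 C\<^sub>2 s v =
     C\<^sub>1 * soft_abs s (infdist (block J v) \<Omega>\<^sub>1) + C\<^sub>2 * soft_abs s (infdist (block (- J) v) \<Omega>\<^sub>2)"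

text \<open>Gradient of the penalty after both distances have been replaced by those to the blocks
  of one fixed nearest point \<open>y\<close>, as a function of the residual
  \<open>r = v - y\<close>.\<close>

definition penalty_normal :: "'m set \<Rightarrow> real \<Rightarrow> real \<Rightarrow> real \<Rightarrow> real^'m \<Rightarrow> real^'m" where
  "penalty_normal J C\<^sub>1 C\<^sub>2 s r =
     (C\<^sub>1 / soft_abs s (norm (block J r))) *\<^sub>R block J r +
     (C\<^sub>2 / soft_abs s (norm (block (- J) r))) *\<^sub>R block (- J) r"

lemma block_penalty_normal:
  "block J (penalty_normal J C\<^sub>1 C\<^sub>2 s r) = (C\<^sub>1 / soft_abs s (norm (block J r))) *\<^sub>R block J r"
  "block (- J) (penalty_normal J C\<^sub>1 C\<^sub>2 s r) = (C\<^sub>2 / soft_abs s (norm (block (- J) r))) *\<^sub>R block (- J) r"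
  by (simp_all add: penalty_normal_def block_add block_scaleR block_block block_block_complement)

text \<open>That the bound is independent of \<open>s\<close> and \<open>r\<close> gives compactness
  of the multipliers as the smoothing vanishes.\<close>

lemma norm_penalty_normal_le:
  assumes "0 < s" "0 \<le> C\<^sub>1" "0 \<le> C\<^sub>2"
  shows "norm (penalty_normal J C\<^sub>1 C\<^sub>2 s r) \<le> C\<^sub>1 + C\<^sub>2"
proof -
  have "norm ((C / soft_abs s (norm w)) *\<^sub>R w) \<le> C" if "0 \<le> C" for C and w :: "real^'a"
    using soft_abs_ge[of "norm w" s] soft_abs_pos[OF assms(1), of "norm w"] that
    by (simp add: divide_le_eq mult_left_mono)
  with assms(2,3) show ?thesis
    unfolding penalty_normal_def by (intro norm_triangle_le add_mono)
qed

lemma has_derivative_soft_abs_norm: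
  fixes g :: "'a::real_normed_vector \<Rightarrow> 'b::real_inner"
  assumes "(g has_derivative g') (at x)" "0 < s"
  shows "((\<lambda>x. soft_abs s (norm (g x))) has_derivative
    (\<lambda>h. (g x \<bullet> g' h) / soft_abs s (norm (g x)))) (at x)"
proof -
  have pos: "0 < g x \<bullet> g x + s\<^sup>2" using assms(2) by (simp add: add_nonneg_pos)
  have "((\<lambda>x. g x \<bullet> g x + s\<^sup>2) has_derivative (\<lambda>h. 2 * (g x \<bullet> g' h))) (at x)"
    by (rule has_derivative_eq_rhs, rule has_derivative_add[OF has_derivative_inner[OF assms(1) assms(1)] has_derivative_const])
       (auto simp: inner_commute)
  from has_derivative_real_sqrt[OF pos this] show ?thesis
    by (simp add: soft_abs_def dot_square_norm field_simps)
qed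

text \<open>With \<open>r\<close> the residual at a nearest point and \<open>w\<close> the step from
  there to another point of the set, expanding the square yields the proximal normal
  inequality.\<close>

lemma proximal_if_nearest:
  fixes r w :: "'a::real_inner"
  assumes "norm r \<le> norm (r - w)"
  shows "r \<bullet> w \<le> (norm w)\<^sup>2 / 2"
proof -
  have "(norm r)\<^sup>2 \<le> (norm (r - w))\<^sup>2" using assms by (intro power_mono) auto
  also have "\<dots> = (norm r)\<^sup>2 - 2 * (r \<bullet> w) + (norm w)\<^sup>2"
    by (simp add: power2_norm_eq_inner inner_diff_left inner_diff_right inner_commute)
  finally show ?thesis by simp
qed

text \<open>The distances need not be differentiable. Freezing nearest points \<open>y1\<close>,
  \<open>y2\<close> gives a differentiable function that majorizes the objective and agrees with it
  at \<open>x\<close>; hence \<open>x\<close> minimizes it locally too, and its gradient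
  vanishes.\<close>

lemma penalty_minimizer_stationary:
  fixes f :: "real^'n \<Rightarrow> real" and F :: "real^'n \<Rightarrow> real^'m"
  assumes f: "f differentiable (at x)" and F: "F differentiable (at x)"
    and s: "0 < s" and C: "0 \<le> C\<^sub>1" "0 \<le> C\<^sub>2"
    and \<Omega>1: "closed \<Omega>\<^sub>1" "\<Omega>\<^sub>1 \<noteq> {}" "\<Omega>\<^sub>1 \<subseteq> block_space J"
    and \<Omega>2: "closed \<Omega>\<^sub>2" "\<Omega>\<^sub>2 \<noteq> {}" "\<Omega>\<^sub>2 \<subseteq> block_space (- J)"
    and \<Omega>: "\<Omega> = {y. block J y \<in> \<Omega>\<^sub>1 \<and> block (- J) y \<in> \<Omega>\<^sub>2}"
    and e: "0 < e"
    and min: "\<And>z. z \<in> ball x e \<Longrightarrow>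
      a * f x + penalty J \<Omega>\<^sub>1 \<Omega>\<^sub>2 C\<^sub>1 C\<^sub>2 s (F x) + \<sigma> * (norm (x - c))\<^sup>2
      \<le> a * f z + penalty J \<Omega>\<^sub>1 \<Omega>\<^sub>2 C\<^sub>1 C\<^sub>2 s (F z) + \<sigma> * (norm (z - c))\<^sup>2"
  shows "\<exists>y\<in>\<Omega>. norm (block J (F x - y)) = infdist (block J (F x)) \<Omega>\<^sub>1 \<and>
    norm (block (- J) (F x - y)) = infdist (block (- J) (F x)) \<Omega>\<^sub>2 \<and>
    (\<exists>K. \<forall>z\<in>\<Omega>. penalty_normal J C\<^sub>1 C\<^sub>2 s (F x - y) \<bullet> (z - y) \<le> K * (norm (z - y))\<^sup>2) \<and>
    a *\<^sub>R gradient f x + penalty_normal J C\<^sub>1 C\<^sub>2 s (F x - y) v* jacobian F (at x)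
      + (2 * \<sigma>) *\<^sub>R (x - c) = 0"
proof -
  obtain y1 where y1: "y1 \<in> \<Omega>\<^sub>1" "infdist (block J (F x)) \<Omega>\<^sub>1 = dist (block J (F x)) y1"
    using infdist_attains_inf[OF \<Omega>1(1,2)] by blast
  obtain y2 where y2: "y2 \<in> \<Omega>\<^sub>2" "infdist (block (- J) (F x)) \<Omega>\<^sub>2 = dist (block (- J) (F x)) y2"
    using infdist_attains_inf[OF \<Omega>2(1,2)] by blast
  \<comment> \<open>The two nearest points lie in complementary coordinate subspaces, so their sum
    has them as its blocks.\<close>
  define y where "y = y1 + y2"
  have yb: "block J y = y1" "block (- J) y = y2"
    using y1(1) y2(1) \<Omega>1(3) \<Omega>2(3)
    by (auto simp: y_def block_add block_id block_zero block_zero' subset_iff)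
  have y: "y \<in> \<Omega>" using yb y1(1) y2(1) \<Omega> by simp
  define r where "r = F x - y"
  have r: "block J r = block J (F x) - y1" "block (- J) r = block (- J) (F x) - y2"
    by (simp_all add: r_def block_diff yb)
  have n: "norm (block J r) = infdist (block J (F x)) \<Omega>\<^sub>1"
    "norm (block (- J) r) = infdist (block (- J) (F x)) \<Omega>\<^sub>2"
    using y1(2) y2(2) by (simp_all add: r dist_norm)
  define l where "l = penalty_normal J C\<^sub>1 C\<^sub>2 s r"
  define k1 k2 where "k1 = C\<^sub>1 / soft_abs s (norm (block J r))"
    and "k2 = C\<^sub>2 / soft_abs s (norm (block (- J) r))"
  have k: "0 \<le> k1" "0 \<le> k2"
    using C soft_abs_pos[OF s] by (simp_all add: k1_def k2_def less_imp_le)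
  have l: "l = k1 *\<^sub>R block J r + k2 *\<^sub>R block (- J) r"
    by (simp add: l_def penalty_normal_def k1_def k2_def)
  \<comment> \<open>Each block of the residual is a proximal normal, and nonnegative weights
    preserve this.\<close>
  have prox: "l \<bullet> (z - y) \<le> ((k1 + k2) / 2) * (norm (z - y))\<^sup>2" if z: "z \<in> \<Omega>" for z
  proof -
    have half: "block I r \<bullet> (z - y) \<le> (norm (z - y))\<^sup>2 / 2"
      if "norm (block I r) \<le> norm (block I r - block I (z - y))" for I
    proof -
      have "block I r \<bullet> (z - y) \<le> (norm (block I (z - y)))\<^sup>2 / 2"
        using proximal_if_nearest[OF that] inner_block[of I r "z - y"] by simp
      also have "\<dots> \<le> (norm (z - y))\<^sup>2 / 2"
        by (intro divide_right_mono power_mono norm_block_le) auto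
      finally show ?thesis .
    qed
    have "norm (block J r) \<le> norm (block J r - block J (z - y))"
      using infdist_le[of "block J z" \<Omega>\<^sub>1 "block J (F x)"] z \<Omega> n(1)
      by (simp add: r block_diff yb dist_norm)
    note h1 = half[OF this]
    have "norm (block (- J) r) \<le> norm (block (- J) r - block (- J) (z - y))"
      using infdist_le[of "block (- J) z" \<Omega>\<^sub>2 "block (- J) (F x)"] z \<Omega> n(2)
      by (simp add: r block_diff yb dist_norm)
    note h2 = half[OF this]
    have "l \<bullet> (z - y) = k1 * (block J r \<bullet> (z - y)) + k2 * (block (- J) r \<bullet> (z - y))"
      by (simp add: l inner_add_left)
    also have "\<dots> \<le> k1 * ((norm (z - y))\<^sup>2 / 2) + k2 * ((norm (z - y))\<^sup>2 / 2)"
      using h1 h2 k by (intro add_mono mult_left_mono)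
    finally show ?thesis by (simp add: algebra_simps add_divide_distrib)
  qed
  define \<phi> where "\<phi> z = a * f z + C\<^sub>1 * soft_abs s (norm (block J (F z) - y1))
    + C\<^sub>2 * soft_abs s (norm (block (- J) (F z) - y2)) + \<sigma> * ((z - c) \<bullet> (z - c))" for z
  define A where "A = jacobian F (at x)"
  have dF: "(F has_derivative (\<lambda>h. A *v h)) (at x)"
    using F jacobian_works unfolding A_def by blast
  have dB: "((\<lambda>z. block I (F z) - w) has_derivative (\<lambda>h. block I (A *v h))) (at x)" for I w
    using has_derivative_diff[OF bounded_linear.has_derivative[OF bounded_linear_block dF] has_derivative_const]
    by simp
  define v where "v = a *\<^sub>R gradient f x + l v* A + (2 * \<sigma>) *\<^sub>R (x - c)"
  have "(\<phi> has_derivative (\<lambda>h. a * (gradient f x \<bullet> h)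
      + C\<^sub>1 * ((block J (F x) - y1) \<bullet> block J (A *v h) / soft_abs s (norm (block J (F x) - y1)))
      + C\<^sub>2 * ((block (- J) (F x) - y2) \<bullet> block (- J) (A *v h) / soft_abs s (norm (block (- J) (F x) - y2)))
      + \<sigma> * ((x - c) \<bullet> h + h \<bullet> (x - c)))) (at x)"
    unfolding \<phi>_def
    by (intro has_derivative_add has_derivative_mult_right has_derivative_gradient[OF f]
        has_derivative_soft_abs_norm[OF dB s] has_derivative_inner)
       (auto intro!: derivative_eq_intros)
  moreover have "a * (gradient f x \<bullet> h)
      + C\<^sub>1 * ((block J (F x) - y1) \<bullet> block J (A *v h) / soft_abs s (norm (block J (F x) - y1)))
      + C\<^sub>2 * ((block (- J) (F x) - y2) \<bullet> block (- J) (A *v h) / soft_abs s (norm (block (- J) (F x) - y2)))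
      + \<sigma> * ((x - c) \<bullet> h + h \<bullet> (x - c)) = v \<bullet> h" for h
    unfolding r[symmetric] inner_block[symmetric]
    by (simp add: v_def inner_add_left dot_lmul_matrix l k1_def k2_def inner_commute[of h])
  ultimately have D: "(\<phi> has_derivative (\<lambda>h. v \<bullet> h)) (at x)" by simp
  have "\<phi> x \<le> \<phi> z" if z: "z \<in> ball x e" for z
  proof -
    have "soft_abs s (infdist (block J (F z)) \<Omega>\<^sub>1) \<le> soft_abs s (norm (block J (F z) - y1)) + 0"
      using infdist_le[OF y1(1)] by (intro soft_abs_mono) (auto simp: infdist_nonneg dist_norm)
    moreover have "soft_abs s (infdist (block (- J) (F z)) \<Omega>\<^sub>2) \<le> soft_abs s (norm (block (- J) (F z) - y2)) + 0"
      using infdist_le[OF y2(1)] by (intro soft_abs_mono) (auto simp: infdist_nonneg dist_norm)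
    ultimately have "penalty J \<Omega>\<^sub>1 \<Omega>\<^sub>2 C\<^sub>1 C\<^sub>2 s (F z) \<le> C\<^sub>1 * soft_abs s (norm (block J (F z) - y1))
       + C\<^sub>2 * soft_abs s (norm (block (- J) (F z) - y2))"
      unfolding penalty_def using C by (intro add_mono mult_left_mono) auto
    moreover have "penalty J \<Omega>\<^sub>1 \<Omega>\<^sub>2 C\<^sub>1 C\<^sub>2 s (F x) = C\<^sub>1 * soft_abs s (norm (block J (F x) - y1))
       + C\<^sub>2 * soft_abs s (norm (block (- J) (F x) - y2))"
      using n by (simp add: penalty_def r)
    ultimately show ?thesis using min[OF z] by (simp add: \<phi>_def power2_norm_eq_inner)
  qed
  then have "(\<lambda>h. v \<bullet> h) = (\<lambda>h. 0)"
    using differential_zero_maxmin[OF _ open_ball D] e by (metis centre_in_ball)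
  then have "v \<bullet> v = 0" by metis
  then have "v = 0" by simp
  then show ?thesis using y n prox unfolding v_def l_def r_def A_def by blast
qed

section \<open>Limits of multipliers\<close>

lemma tendsto_vector_matrix_mult:
  fixes A :: "'b \<Rightarrow> real^'n^'m"
  assumes "(l \<longlongrightarrow> l0) G" "(A \<longlongrightarrow> A0) G"
  shows "((\<lambda>k. l k v* A k) \<longlongrightarrow> l0 v* A0) G"
  unfolding vector_matrix_mult_def by (intro tendsto_vec_lambda tendsto_intros assms)

lemma differentiable_vector_matrix_mult:
  fixes A :: "'a::real_normed_vector \<Rightarrow> real^'n^'m"
  assumes "A differentiable (at x)"
  shows "(\<lambda>y. l v* A y) differentiable (at x)"
proof -
  have "linear (\<lambda>M :: real^'n^'m. l v* M)"
    by (rule linearI) (simp_all add: vector_matrix_mult_def vec_eq_iff sum.distrib sum_distrib_left algebra_simps)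
  then have "bounded_linear (\<lambda>M :: real^'n^'m. l v* M)" by (simp add: linear_conv_bounded_linear)
  from bounded_linear.has_derivative[OF this] assms show ?thesis
    unfolding differentiable_def by blast
qed

lemma differentiable_lagrangian:
  assumes "f differentiable (at x)" "F differentiable (at x)"
  shows "(\<lambda>y. lagrangian f F y a l) differentiable (at x)"
proof -
  obtain f' F' where "(f has_derivative f') (at x)" "(F has_derivative F') (at x)"
    using assms unfolding differentiable_def by blast
  from has_derivative_add[OF has_derivative_mult_right[OF this(1), of a] has_derivative_inner_right[OF this(2), of l]]
  show ?thesis unfolding differentiable_def lagrangian_def by blast
qed

lemma differentiable_gradient_lagrangian:
  assumes "\<And>y. f differentiable (at y)" "\<And>y. F differentiable (at y)"
    and "twice_diff_real_at f x" "twice_diff_vec_at F x"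
  shows "gradient (\<lambda>y. lagrangian f F y a l) differentiable (at x)"
proof -
  have "gradient (\<lambda>y. lagrangian f F y a l) = (\<lambda>y. a *\<^sub>R gradient f y + l v* jacobian F (at y))"
    using gradient_lagrangian[OF assms(1,2)] by blast
  moreover have "(\<lambda>y. a *\<^sub>R gradient f y + l v* jacobian F (at y)) differentiable (at x)"
    using assms(3,4) unfolding twice_diff_real_at_def twice_diff_vec_at_def
    by (intro differentiable_add differentiable_scaleR differentiable_const differentiable_vector_matrix_mult) auto
  ultimately show ?thesis by simp
qed

text \<open>Both cases end here. A residual of order o(t) lets \<open>y k\<close> approach
  \<open>F x\<close> in the same direction as \<open>F (X k)\<close>; an \<open>s\<close> of order
  o(t^2) disappears in the second-order quotient; \<open>lower\<close> is exactness of the penalty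
  with the smaller constant \<open>C'\<close>.\<close>

lemma limit_multiplier:
  fixes f :: "real^'n \<Rightarrow> real" and F :: "real^'n \<Rightarrow> real^'m"
  assumes f: "cont_diff_real f" and F: "cont_diff_vec F"
    and \<Omega>: "finite_union_polyhedra \<Omega>" "F x \<in> \<Omega>"
    and t: "\<And>k. 0 < t k" "t \<longlonglongrightarrow> 0" and v: "v \<longlonglongrightarrow> u"
    and X: "\<And>k. X k = x + t k *\<^sub>R v k"
    and y: "\<And>k. y k \<in> \<Omega>" "(\<lambda>k. (F (X k) - y k) /\<^sub>R t k) \<longlonglongrightarrow> 0"
    and s: "\<And>k. 0 < s k" "(\<lambda>k. s k / (t k)\<^sup>2) \<longlonglongrightarrow> 0"
    and C: "0 \<le> C'" "C' < C\<^sub>1" "C' < C\<^sub>2"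
    and l: "\<And>k. l k = penalty_normal J C\<^sub>1 C\<^sub>2 (s k) (F (X k) - y k)"
    and prox: "\<And>k z. z \<in> \<Omega> \<Longrightarrow> l k \<bullet> (z - y k) \<le> K k * (norm (z - y k))\<^sup>2"
    and stat: "(\<lambda>k. a *\<^sub>R gradient f (X k) + l k v* jacobian F (at (X k))) \<longlonglongrightarrow> 0"
    and lower: "\<And>k. a * f x \<le> a * f (X k) +
      C' * (norm (block J (F (X k) - y k)) + norm (block (- J) (F (X k) - y k)))"
  shows "\<exists>r \<mu>. strict_mono r \<and> (l \<circ> r) \<longlonglongrightarrow> \<mu> \<and>
    \<mu> \<in> dir_normal_cone (F x) \<Omega> (jacobian F (at x) *v u) \<and>
    gradient (\<lambda>y. lagrangian f F y a \<mu>) x = 0 \<and>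
    (twice_diff_real_at f x \<and> twice_diff_vec_at F x \<longrightarrow>
      0 \<le> u \<bullet> (hessian (\<lambda>y. lagrangian f F y a \<mu>) x *v u))"
proof -
  have df: "\<And>y. f differentiable (at y)" "\<And>y. F differentiable (at y)"
    using f F by (auto simp: cont_diff_real_def cont_diff_vec_def)
  have X_lim: "X \<longlonglongrightarrow> x"
    using tendsto_add[OF tendsto_const tendsto_scaleR[OF t(2) v], of x] by (simp add: X[abs_def])
  have dF: "(F has_derivative (\<lambda>h. jacobian F (at x) *v h)) (at x)"
    using df(2) jacobian_works by blast
  have lim1: "(\<lambda>k. (F (X k) - F x) /\<^sub>R t k) \<longlonglongrightarrow> jacobian F (at x) *v u"
    using hadamard_derivative[OF dF t v] by (simp add: X)
  define w where "w k = (y k - F x) /\<^sub>R t k" for k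
  have "w k = (F (X k) - F x) /\<^sub>R t k - (F (X k) - y k) /\<^sub>R t k" for k
    by (simp add: w_def flip: scaleR_diff_right)
  then have w: "w \<longlonglongrightarrow> jacobian F (at x) *v u"
    using tendsto_diff[OF lim1 y(2)] by (simp add: w_def[abs_def])
  have yw: "y k = F x + t k *\<^sub>R w k" for k using t(1)[of k] by (simp add: w_def)
  have y_lim: "y \<longlonglongrightarrow> F x"
    using tendsto_add[OF tendsto_const tendsto_scaleR[OF t(2) w], of "F x"] by (simp add: yw[abs_def])

  have "norm (l k) \<le> C\<^sub>1 + C\<^sub>2" for k
    unfolding l using C by (intro norm_penalty_normal_le s) auto
  then have "\<forall>k. l k \<in> cball 0 (C\<^sub>1 + C\<^sub>2)" by simp
  then obtain \<mu> r1 where r1: "strict_mono r1" "(l \<circ> r1) \<longlonglongrightarrow> \<mu>"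
    using seq_compactE[OF compact_imp_seq_compact[OF compact_cball]] by metis
  \<comment> \<open>Orthogonality across different indices is what allows the index of the
    multiplier to go to infinity while the point stays fixed, so that it passes to
    \<open>\<mu>\<close>.\<close>
  have "\<exists>r2::nat \<Rightarrow> nat. strict_mono r2 \<and> (\<forall>k j. (l \<circ> r1) (r2 k) \<bullet> ((y \<circ> r1) (r2 j) - F x) = 0)"
  proof (rule proximal_normals_orthogonal_subseq[OF \<Omega>(1)])
    show "(y \<circ> r1) \<longlonglongrightarrow> F x" using y_lim r1(1) by (rule LIMSEQ_subseq_LIMSEQ)
    show "(l \<circ> r1) k \<bullet> (z - (y \<circ> r1) k) \<le> (K \<circ> r1) k * (norm (z - (y \<circ> r1) k))\<^sup>2" if "z \<in> \<Omega>" for k z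
      using prox[OF that] by simp
  qed (simp add: y(1))
  then obtain r2 :: "nat \<Rightarrow> nat" where r2: "strict_mono r2" "\<And>k j. l (r1 (r2 k)) \<bullet> (y (r1 (r2 j)) - F x) = 0"
    by auto
  define r where "r = r1 \<circ> r2"
  have r: "strict_mono r" using r1(1) r2(1) by (simp add: r_def strict_mono_o)
  have sub: "Z \<longlonglongrightarrow> z \<Longrightarrow> (\<lambda>k. Z (r k)) \<longlonglongrightarrow> z" for Z :: "nat \<Rightarrow> 'z::topological_space" and z
    using LIMSEQ_subseq_LIMSEQ[OF _ r, of Z z] by (simp add: comp_def)
  have l_lim: "(\<lambda>k. l (r k)) \<longlonglongrightarrow> \<mu>"
    using LIMSEQ_subseq_LIMSEQ[OF r1(2) r2(1)] by (simp add: r_def comp_def)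
  have orth: "\<mu> \<bullet> (y (r j) - F x) = 0" for j
  proof -
    have "(\<lambda>k. l (r k) \<bullet> (y (r j) - F x)) \<longlonglongrightarrow> \<mu> \<bullet> (y (r j) - F x)"
      by (intro tendsto_intros l_lim)
    moreover have "(\<lambda>k. l (r k) \<bullet> (y (r j) - F x)) = (\<lambda>k. 0)" using r2(2) by (simp add: r_def)
    ultimately show ?thesis by (simp add: LIMSEQ_const_iff)
  qed

  have normal: "\<mu> \<in> dir_normal_cone (F x) \<Omega> (jacobian F (at x) *v u)"
  proof -
    have "l (r k) \<in> frechet_normal_cone (F x + t (r k) *\<^sub>R w (r k)) \<Omega>" for k
      using frechet_normal_cone_if_proximal[OF y(1) prox] by (simp flip: yw)
    then show ?thesis
      unfolding dir_normal_cone_def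
      by - (intro CollectI conjI \<Omega>(2), rule exI[of _ "\<lambda>k. t (r k)"],
          rule exI[of _ "\<lambda>k. w (r k)"], rule exI[of _ "\<lambda>k. l (r k)"],
          simp add: t(1) sub[OF t(2)] sub[OF w] l_lim)
  qed

  have g0: "gradient (\<lambda>y. lagrangian f F y a \<mu>) x = 0"
  proof -
    have "isCont (gradient f) x" "isCont (\<lambda>y. jacobian F (at y)) x"
      using f F by (simp_all add: cont_diff_real_def cont_diff_vec_def continuous_on_eq_continuous_at)
    then have c: "(\<lambda>k. gradient f (X (r k))) \<longlonglongrightarrow> gradient f x"
      "(\<lambda>k. jacobian F (at (X (r k)))) \<longlonglongrightarrow> jacobian F (at x)"
      using sub[OF X_lim] by (auto intro: isCont_tendsto_compose)
    have "(\<lambda>k. a *\<^sub>R gradient f (X (r k)) + l (r k) v* jacobian F (at (X (r k))))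
        \<longlonglongrightarrow> a *\<^sub>R gradient f x + \<mu> v* jacobian F (at x)"
      by (intro tendsto_intros tendsto_vector_matrix_mult c l_lim)
    from LIMSEQ_unique[OF this sub[OF stat]] show ?thesis
      by (simp add: gradient_lagrangian df)
  qed

  have second: "0 \<le> u \<bullet> (hessian (\<lambda>y. lagrangian f F y a \<mu>) x *v u)"
    if tw: "twice_diff_real_at f x" "twice_diff_vec_at F x"
  proof -
    define L where "L = (\<lambda>y. lagrangian f F y a \<mu>)"
    have lim: "(\<lambda>k. (L (x + t (r k) *\<^sub>R v (r k)) - L x) / (t (r k))\<^sup>2) \<longlonglongrightarrow> (u \<bullet> (hessian L x *v u)) / 2"
    proof (rule second_order_limit)
      show "\<And>y. L differentiable (at y)" unfolding L_def by (intro differentiable_lagrangian df)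
      show "gradient L differentiable (at x)"
        unfolding L_def by (intro differentiable_gradient_lagrangian df tw)
      show "gradient L x = 0" using g0 by (simp add: L_def)
    qed (use t(1) sub[OF t(2)] sub[OF v] in auto)
    \<comment> \<open>Once \<open>l\<close> is this close to \<open>\<mu>\<close>, replacing it by
      \<open>\<mu>\<close> is paid for by the gap in either block.\<close>
    define d where "d = min (C\<^sub>1 - C') (C\<^sub>2 - C')"
    have "d > 0" using C by (simp add: d_def)
    then have "\<forall>\<^sub>F k in sequentially. dist (l (r k)) \<mu> < d" using l_lim by (rule tendstoD[rotated])
    then have "\<forall>\<^sub>F k in sequentially.
        - (C\<^sub>1 + C\<^sub>2) * (s (r k) / (t (r k))\<^sup>2) \<le> (L (x + t (r k) *\<^sub>R v (r k)) - L x) / (t (r k))\<^sup>2"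
    proof eventually_elim
      case (elim k)
      define j where "j = r k"
      define q where "q = F (X j) - y j"
      have near: "norm (block I \<mu> - block I (l j)) \<le> d" for I
        using elim norm_block_le[of I "\<mu> - l j"] by (simp add: block_diff j_def dist_norm norm_minus_commute)
      have "C' * norm (block J q) - C\<^sub>1 * s j \<le> block J \<mu> \<bullet> block J q"
        using near[of J] C s(1)
        by (intro soft_abs_inner_ge) (auto simp: l block_penalty_normal d_def q_def)
      moreover have "C' * norm (block (- J) q) - C\<^sub>2 * s j \<le> block (- J) \<mu> \<bullet> block (- J) q"
        using near[of "- J"] C s(1)
        by (intro soft_abs_inner_ge) (auto simp: l block_penalty_normal d_def q_def)
      moreover have "\<mu> \<bullet> q = block J \<mu> \<bullet> block J q + block (- J) \<mu> \<bullet> block (- J) q"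
        by (metis block_complement inner_add_left inner_block)
      \<comment> \<open>The last term vanishes by orthogonality; a mere bound of order t would not
        survive division by t^2.\<close>
      moreover have "L (X j) - L x = a * f (X j) - a * f x + \<mu> \<bullet> q + \<mu> \<bullet> (y j - F x)"
        by (simp add: L_def lagrangian_def q_def inner_diff_right)
      ultimately have "- (C\<^sub>1 + C\<^sub>2) * s j \<le> L (X j) - L x"
        using lower[of j] orth[of k] by (simp add: q_def j_def algebra_simps)
      then have "- (C\<^sub>1 + C\<^sub>2) * s j / (t j)\<^sup>2 \<le> (L (X j) - L x) / (t j)\<^sup>2"
        by (intro divide_right_mono) auto
      then show ?case by (simp add: j_def X)
    qed
    moreover have "(\<lambda>k. - (C\<^sub>1 + C\<^sub>2) * (s (r k) / (t (r k))\<^sup>2)) \<longlonglongrightarrow> - (C\<^sub>1 + C\<^sub>2) * 0"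
      by (intro tendsto_intros sub[OF s(2)])
    ultimately have "- (C\<^sub>1 + C\<^sub>2) * 0 \<le> (u \<bullet> (hessian L x *v u)) / 2"
      using lim by (intro tendsto_le[OF sequentially_bot])
    then show ?thesis by (simp add: L_def)
  qed
  have "(l \<circ> r) \<longlonglongrightarrow> \<mu>" using l_lim by (simp add: comp_def)
  with r normal g0 second show ?thesis by blast
qed

section \<open>Almost stationary points\<close>

lemma cont_diff_real_lipschitz_near:
  fixes f :: "real^'n \<Rightarrow> real"
  assumes "cont_diff_real f"
  shows "\<exists>r>0. \<exists>B>0. \<forall>y\<in>ball x r. \<forall>z\<in>ball x r. norm (f y - f z) \<le> B * norm (y - z)"
proof -
  have "isCont (gradient f) x"
    using assms by (simp add: cont_diff_real_def continuous_on_eq_continuous_at)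
  then obtain r where r: "r > 0" "\<And>y. dist y x < r \<Longrightarrow> dist (gradient f y) (gradient f x) < 1"
    unfolding continuous_at_eps_delta using zero_less_one by blast
  define c where "c = norm (gradient f x) + 1"
  have "\<forall>y\<in>ball x r. \<forall>z\<in>ball x r. norm (f y - f z) \<le> c * norm (y - z)"
  proof (rule lipschitz_near[where F' = "\<lambda>y h. gradient f y \<bullet> h"])
    fix y assume y: "y \<in> ball x r"
    show "(f has_derivative (\<lambda>h. gradient f y \<bullet> h)) (at y)"
      using assms by (intro has_derivative_gradient) (simp add: cont_diff_real_def)
    have "norm (gradient f y) \<le> norm (gradient f x) + dist (gradient f y) (gradient f x)"
      by (metis dist_norm norm_triangle_sub)
    also have "\<dots> \<le> c" using r(2)[of y] y by (simp add: c_def dist_commute)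
    finally have n: "norm (gradient f y) \<le> c" .
    have "norm (gradient f y \<bullet> h) \<le> c * norm h" for h
      using Cauchy_Schwarz_ineq2[of "gradient f y" h] mult_right_mono[OF n norm_ge_zero[of h]] by simp
    then show "onorm (\<lambda>h. gradient f y \<bullet> h) \<le> c" by (rule onorm_le)
  qed
  moreover have "c > 0" by (simp add: c_def add_nonneg_pos)
  ultimately show ?thesis using r(1) by (intro exI[of _ r] conjI exI[of _ c]) simp_all
qed

locale split_problem =
  fixes f :: "real^'n \<Rightarrow> real" and F :: "real^'n \<Rightarrow> real^'m"
    and \<Omega> \<Omega>\<^sub>1 \<Omega>\<^sub>2 :: "(real^'m) set" and J :: "'m set"
  assumes f: "cont_diff_real f" and F: "cont_diff_vec F"
    and \<Omega>: "finite_union_polyhedra \<Omega>" "\<Omega> \<noteq> {}" "\<Omega> = {y. block J y \<in> \<Omega>\<^sub>1 \<and> block (- J) y \<in> \<Omega>\<^sub>2}"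
    and \<Omega>1: "closed \<Omega>\<^sub>1" "\<Omega>\<^sub>1 \<subseteq> block_space J"
    and \<Omega>2: "closed \<Omega>\<^sub>2" "\<Omega>\<^sub>2 \<subseteq> block_space (- J)"
begin

definition dist1 :: "real^'n \<Rightarrow> real" where "dist1 z = infdist (block J (F z)) \<Omega>\<^sub>1"
definition dist2 :: "real^'n \<Rightarrow> real" where "dist2 z = infdist (block (- J) (F z)) \<Omega>\<^sub>2"

definition merit :: "real \<Rightarrow> real \<Rightarrow> real \<Rightarrow> real \<Rightarrow> real^'n \<Rightarrow> real" where
  "merit a C\<^sub>1 C\<^sub>2 s z = a * f z + C\<^sub>1 * soft_abs s (dist1 z) + C\<^sub>2 * soft_abs s (dist2 z)"

text \<open>The multiplier is carried implicitly as the penalty normal of \<open>F z - y\<close>,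
  with \<open>y\<close> nearest in both blocks; \<open>\<epsilon>\<close> leaves room for the
  gradient of the proximal term.\<close>

definition almost_stationary ::
  "real \<Rightarrow> real \<Rightarrow> real \<Rightarrow> real \<Rightarrow> real \<Rightarrow> real^'n \<Rightarrow> real^'m \<Rightarrow> bool" where
  "almost_stationary a C\<^sub>1 C\<^sub>2 s \<epsilon> z y \<longleftrightarrow> y \<in> \<Omega> \<and>
    norm (block J (F z - y)) = dist1 z \<and> norm (block (- J) (F z - y)) = dist2 z \<and>
    (\<exists>K. \<forall>y'\<in>\<Omega>. penalty_normal J C\<^sub>1 C\<^sub>2 s (F z - y) \<bullet> (y' - y) \<le> K * (norm (y' - y))\<^sup>2) \<and>
    norm (a *\<^sub>R gradient f z + penalty_normal J C\<^sub>1 C\<^sub>2 s (F z - y) v* jacobian F (at z)) \<le> \<epsilon>"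

lemma diff: "f differentiable (at z)" "F differentiable (at z)"
  using f F by (auto simp: cont_diff_real_def cont_diff_vec_def)

lemma blocks_nonempty: "\<Omega>\<^sub>1 \<noteq> {}" "\<Omega>\<^sub>2 \<noteq> {}"
  using \<Omega>(2,3) by auto

lemma dist_nonneg: "0 \<le> dist1 z" "0 \<le> dist2 z"
  by (simp_all add: dist1_def dist2_def infdist_nonneg)

lemma dist_le: "dist1 z \<le> infdist (F z) \<Omega>" "dist2 z \<le> infdist (F z) \<Omega>"
  unfolding dist1_def dist2_def using \<Omega>(2,3) by (auto intro!: infdist_block_le)

lemma continuous_f: "continuous_on A f"
  using diff(1) by (meson differentiable_imp_continuous_on differentiable_at_withinI differentiable_on_def)

lemma continuous_F: "continuous_on A F"
  using diff(2) by (meson differentiable_imp_continuous_on differentiable_at_withinI differentiable_on_def)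

lemma continuous_dist: "continuous_on A dist1" "continuous_on A dist2"
proof -
  have c: "continuous_on A (\<lambda>z. block I (F z))" for I
    by (rule bounded_linear.continuous_on[OF bounded_linear_block continuous_F])
  show "continuous_on A dist1" "continuous_on A dist2"
    unfolding dist1_def[abs_def] dist2_def[abs_def] by (intro continuous_on_infdist c)+
qed

lemma continuous_merit: "continuous_on A (merit a C\<^sub>1 C\<^sub>2 s)"
  unfolding merit_def[abs_def] soft_abs_def
  by (intro continuous_intros continuous_f continuous_dist)

lemma merit_ge:
  assumes "0 \<le> C\<^sub>1" "0 \<le> C\<^sub>2"
  shows "a * f z + C\<^sub>1 * dist1 z + C\<^sub>2 * dist2 z \<le> merit a C\<^sub>1 C\<^sub>2 s z"
  unfolding merit_def by (rule add_mono[OF add_left_mono]; intro mult_left_mono soft_abs_ge assms)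

lemma merit_le:
  assumes "0 \<le> C\<^sub>1" "0 \<le> C\<^sub>2" "0 \<le> s"
  shows "merit a C\<^sub>1 C\<^sub>2 s z \<le> a * f z + C\<^sub>1 * (dist1 z + s) + C\<^sub>2 * (dist2 z + s)"
  unfolding merit_def by (rule add_mono[OF add_left_mono]; intro mult_left_mono soft_abs_le dist_nonneg assms)

lemma feasible_iff: "F z \<in> \<Omega> \<longleftrightarrow> dist1 z = 0 \<and> dist2 z = 0"
  using in_closed_iff_infdist_zero[OF \<Omega>1(1) blocks_nonempty(1)]
    in_closed_iff_infdist_zero[OF \<Omega>2(1) blocks_nonempty(2)] \<Omega>(3)
  by (simp add: dist1_def dist2_def)

lemma closed_feasible: "closed {z. F z \<in> \<Omega>}" "closed {z. dist2 z = 0}"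
proof -
  show 1: "closed {z. dist2 z = 0}"
    using continuous_closed_preimage_constant[OF continuous_dist(2) closed_UNIV] by simp
  have "closed {z. dist1 z = 0}"
    using continuous_closed_preimage_constant[OF continuous_dist(1) closed_UNIV] by simp
  from closed_Int[OF this 1] show "closed {z. F z \<in> \<Omega>}"
    by (simp add: feasible_iff Collect_conj_eq)
qed

text \<open>Nearest points of the two blocks add up to a point of \<open>\<Omega>\<close>. This
  turns a subregularity estimate for the whole constraint into one by the separate
  residuals.\<close>

lemma infdist_le_dist: "infdist (F z) \<Omega> \<le> dist1 z + dist2 z"
proof -
  obtain y1 where y1: "y1 \<in> \<Omega>\<^sub>1" "dist1 z = dist (block J (F z)) y1"
    using infdist_attains_inf[OF \<Omega>1(1) blocks_nonempty(1)] unfolding dist1_def by blast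
  obtain y2 where y2: "y2 \<in> \<Omega>\<^sub>2" "dist2 z = dist (block (- J) (F z)) y2"
    using infdist_attains_inf[OF \<Omega>2(1) blocks_nonempty(2)] unfolding dist2_def by blast
  have "block J (y1 + y2) = y1" "block (- J) (y1 + y2) = y2"
    using y1(1) y2(1) \<Omega>1(2) \<Omega>2(2) by (auto simp: block_add block_id block_zero block_zero' subset_iff)
  then have "y1 + y2 \<in> \<Omega>" using y1(1) y2(1) \<Omega>(3) by simp
  then have "infdist (F z) \<Omega> \<le> dist (F z) (y1 + y2)" by (rule infdist_le)
  also have "\<dots> = norm ((block J (F z) - y1) + (block (- J) (F z) - y2))"
    using block_complement[of J "F z"] by (simp add: dist_norm algebra_simps)
  also have "\<dots> \<le> dist1 z + dist2 z"
    unfolding y1(2) y2(2) dist_norm by (rule norm_triangle_ineq)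
  finally show ?thesis .
qed

text \<open>With weight \<open>4 * \<eta> / \<rho>\<^sup>2\<close> the proximal term reaches
  \<open>\<eta>\<close>, the largest possible gain, at distance \<rho>/2. The minimizer over the
  ball is therefore interior, and the gradient of the term is at most
  \<open>4 * \<eta> / \<rho>\<close>. The comparison inequality is retained for testing the
  minimizer against a specific competitor.\<close>

lemma almost_stationary_exists:
  assumes s: "0 < s" and C: "0 \<le> C\<^sub>1" "0 \<le> C\<^sub>2" and \<rho>: "0 < \<rho>"
    and base: "merit a C\<^sub>1 C\<^sub>2 s c \<le> m + \<eta>"
    and lower: "\<And>z. z \<in> cball c \<rho> \<Longrightarrow> m \<le> merit a C\<^sub>1 C\<^sub>2 s z"
  shows "\<exists>z y. norm (z - c) \<le> \<rho> / 2 \<and> almost_stationary a C\<^sub>1 C\<^sub>2 s (4 * \<eta> / \<rho>) z y \<and>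
    merit a C\<^sub>1 C\<^sub>2 s z \<le> merit a C\<^sub>1 C\<^sub>2 s c \<and>
    (\<forall>z'\<in>cball c \<rho>. merit a C\<^sub>1 C\<^sub>2 s z + 4 * \<eta> / \<rho>\<^sup>2 * (norm (z - c))\<^sup>2
       \<le> merit a C\<^sub>1 C\<^sub>2 s z' + 4 * \<eta> / \<rho>\<^sup>2 * (norm (z' - c))\<^sup>2)"
proof -
  define P where "P = merit a C\<^sub>1 C\<^sub>2 s"
  define \<sigma> where "\<sigma> = 4 * \<eta> / \<rho>\<^sup>2"
  have "m \<le> P c" using lower[of c] \<rho> by (simp add: P_def)
  then have \<eta>: "0 \<le> \<eta>" using base by (simp add: P_def)
  have \<sigma>: "0 \<le> \<sigma>" using \<eta> by (simp add: \<sigma>_def)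
  have "continuous_on (cball c \<rho>) (\<lambda>z. P z + \<sigma> * (norm (z - c))\<^sup>2)"
    unfolding P_def by (intro continuous_intros continuous_merit)
  moreover have "cball c \<rho> \<noteq> {}" using \<rho> by simp
  ultimately obtain z where z: "z \<in> cball c \<rho>"
    "\<And>z'. z' \<in> cball c \<rho> \<Longrightarrow> P z + \<sigma> * (norm (z - c))\<^sup>2 \<le> P z' + \<sigma> * (norm (z' - c))\<^sup>2"
    using continuous_attains_inf[OF compact_cball] by blast
  have Pc: "P z + \<sigma> * (norm (z - c))\<^sup>2 \<le> P c" using z(2)[of c] \<rho> by simp
  have near: "norm (z - c) \<le> \<rho> / 2 \<or> \<eta> = 0"
  proof (rule disjCI)
    assume "\<eta> \<noteq> 0"
    then have pos: "\<eta> > 0" using \<eta> by simp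
    have "\<sigma> * (norm (z - c))\<^sup>2 \<le> \<eta>" using Pc base lower[OF z(1)] by (simp add: P_def)
    then have "\<sigma> * (norm (z - c))\<^sup>2 * \<rho>\<^sup>2 \<le> \<eta> * \<rho>\<^sup>2" by (intro mult_right_mono) auto
    moreover have "\<sigma> * (norm (z - c))\<^sup>2 * \<rho>\<^sup>2 = \<eta> * (4 * (norm (z - c))\<^sup>2)"
      using \<rho> by (simp add: \<sigma>_def)
    ultimately have "\<eta> * (4 * (norm (z - c))\<^sup>2) \<le> \<eta> * \<rho>\<^sup>2" by (simp only:)
    then have "4 * (norm (z - c))\<^sup>2 \<le> \<rho>\<^sup>2" by (rule mult_left_le_imp_le[OF _ pos])
    moreover have "(2 * norm (z - c))\<^sup>2 = 4 * (norm (z - c))\<^sup>2" by (simp only: power_mult_distrib) simp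
    ultimately have "(2 * norm (z - c))\<^sup>2 \<le> \<rho>\<^sup>2" by (simp only:)
    then have "2 * norm (z - c) \<le> \<rho>" by (rule power2_le_imp_le) (use \<rho> in simp)
    then show "norm (z - c) \<le> \<rho> / 2" by simp
  qed
  \<comment> \<open>For \<open>\<eta> = 0\<close> the weight is zero and does not localize the
    minimizer, but then the centre \<open>c\<close> is itself a minimizer.\<close>
  define z0 where "z0 = (if \<eta> = 0 then c else z)"
  have z0: "norm (z0 - c) \<le> \<rho> / 2"
    "\<And>z'. z' \<in> cball c \<rho> \<Longrightarrow> P z0 + \<sigma> * (norm (z0 - c))\<^sup>2 \<le> P z' + \<sigma> * (norm (z' - c))\<^sup>2"
    "P z0 \<le> P c"
  proof -
    show "norm (z0 - c) \<le> \<rho> / 2" using near \<rho> by (auto simp: z0_def)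
    show "P z0 \<le> P c"
    proof (cases "\<eta> = 0")
      case False
      have "0 \<le> \<sigma> * (norm (z - c))\<^sup>2" using \<sigma> by simp
      then show ?thesis using Pc False by (simp add: z0_def)
    qed (simp add: z0_def)
    show "P z0 + \<sigma> * (norm (z0 - c))\<^sup>2 \<le> P z' + \<sigma> * (norm (z' - c))\<^sup>2" if "z' \<in> cball c \<rho>" for z'
    proof (cases "\<eta> = 0")
      case True
      then show ?thesis using base lower[OF that] by (simp add: z0_def \<sigma>_def P_def)
    next
      case False
      then show ?thesis using z(2)[OF that] by (simp add: z0_def)
    qed
  qed
  have "\<exists>y\<in>\<Omega>. norm (block J (F z0 - y)) = infdist (block J (F z0)) \<Omega>\<^sub>1 \<and>
    norm (block (- J) (F z0 - y)) = infdist (block (- J) (F z0)) \<Omega>\<^sub>2 \<and>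
    (\<exists>K. \<forall>y'\<in>\<Omega>. penalty_normal J C\<^sub>1 C\<^sub>2 s (F z0 - y) \<bullet> (y' - y) \<le> K * (norm (y' - y))\<^sup>2) \<and>
    a *\<^sub>R gradient f z0 + penalty_normal J C\<^sub>1 C\<^sub>2 s (F z0 - y) v* jacobian F (at z0)
      + (2 * \<sigma>) *\<^sub>R (z0 - c) = 0"
  proof (rule penalty_minimizer_stationary[OF diff s C \<Omega>1(1) blocks_nonempty(1) \<Omega>1(2)
        \<Omega>2(1) blocks_nonempty(2) \<Omega>2(2) \<Omega>(3), where e = "\<rho> / 2"])
    fix z' assume "z' \<in> ball z0 (\<rho> / 2)"
    then have "norm (z' - z0) \<le> \<rho> / 2" by (simp add: dist_norm norm_minus_commute)
    then have "norm (z' - c) \<le> \<rho>" using norm_triangle_ineq[of "z' - z0" "z0 - c"] z0(1) by simp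
    then have "z' \<in> cball c \<rho>" by (simp add: dist_norm norm_minus_commute)
    from z0(2)[OF this]
    show "a * f z0 + penalty J \<Omega>\<^sub>1 \<Omega>\<^sub>2 C\<^sub>1 C\<^sub>2 s (F z0) + \<sigma> * (norm (z0 - c))\<^sup>2
      \<le> a * f z' + penalty J \<Omega>\<^sub>1 \<Omega>\<^sub>2 C\<^sub>1 C\<^sub>2 s (F z') + \<sigma> * (norm (z' - c))\<^sup>2"
      by (simp add: P_def merit_def penalty_def dist1_def dist2_def add.assoc)
  qed (use \<rho> in simp)
  then obtain y where y: "y \<in> \<Omega>" "norm (block J (F z0 - y)) = dist1 z0" "norm (block (- J) (F z0 - y)) = dist2 z0"
    "\<exists>K. \<forall>y'\<in>\<Omega>. penalty_normal J C\<^sub>1 C\<^sub>2 s (F z0 - y) \<bullet> (y' - y) \<le> K * (norm (y' - y))\<^sup>2"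
    and eq: "a *\<^sub>R gradient f z0 + penalty_normal J C\<^sub>1 C\<^sub>2 s (F z0 - y) v* jacobian F (at z0)
      + (2 * \<sigma>) *\<^sub>R (z0 - c) = 0"
    unfolding dist1_def dist2_def by blast
  have "norm (a *\<^sub>R gradient f z0 + penalty_normal J C\<^sub>1 C\<^sub>2 s (F z0 - y) v* jacobian F (at z0))
    = 2 * \<sigma> * norm (z0 - c)"
    using \<sigma> eq by (simp add: add_eq_0_iff2)
  also have "\<dots> \<le> 2 * \<sigma> * (\<rho> / 2)" using z0(1) \<sigma> by (intro mult_left_mono) auto
  also have "\<dots> = 4 * \<eta> / \<rho>" using \<rho> by (simp add: \<sigma>_def power2_eq_square)
  finally have "almost_stationary a C\<^sub>1 C\<^sub>2 s (4 * \<eta> / \<rho>) z0 y"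
    using y by (simp add: almost_stationary_def)
  with z0 show ?thesis unfolding P_def \<sigma>_def by blast
qed

text \<open>The sum of the block distances bounds the residual, and the cubic bound on
  \<open>s\<close> yields \<open>s k / (t k)\<^sup>2 \<le> t k\<close>.\<close>

lemma limit_of_almost_stationary:
  assumes x: "F x \<in> \<Omega>" and t: "\<And>k. 0 < t k" "t \<longlonglongrightarrow> 0"
    and X: "(\<lambda>k. (X k - x) /\<^sub>R t k) \<longlonglongrightarrow> u"
    and st: "\<And>k. almost_stationary a C\<^sub>1 C\<^sub>2 (s k) (\<epsilon> k) (X k) (y k)" "\<epsilon> \<longlonglongrightarrow> 0"
    and d: "(\<lambda>k. (dist1 (X k) + dist2 (X k)) / t k) \<longlonglongrightarrow> 0"
    and s: "\<And>k. 0 < s k" "\<And>k. s k \<le> (t k) ^ 3"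
    and C: "0 \<le> C'" "C' < C\<^sub>1" "C' < C\<^sub>2"
    and lower: "\<And>k. a * f x \<le> a * f (X k) + C' * (dist1 (X k) + dist2 (X k))"
  shows "\<exists>r \<mu>. strict_mono r \<and> (\<lambda>k. penalty_normal J C\<^sub>1 C\<^sub>2 (s (r k)) (F (X (r k)) - y (r k))) \<longlonglongrightarrow> \<mu> \<and>
    \<mu> \<in> dir_normal_cone (F x) \<Omega> (jacobian F (at x) *v u) \<and>
    gradient (\<lambda>y. lagrangian f F y a \<mu>) x = 0 \<and>
    (twice_diff_real_at f x \<and> twice_diff_vec_at F x \<longrightarrow>
      0 \<le> u \<bullet> (hessian (\<lambda>y. lagrangian f F y a \<mu>) x *v u))"
proof -
  define l where "l k = penalty_normal J C\<^sub>1 C\<^sub>2 (s k) (F (X k) - y k)" for k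
  note st' = st(1)[unfolded almost_stationary_def]
  obtain K where K: "\<And>k z. z \<in> \<Omega> \<Longrightarrow> l k \<bullet> (z - y k) \<le> K k * (norm (z - y k))\<^sup>2"
    using st' unfolding l_def by metis
  have "\<exists>r \<mu>. strict_mono r \<and> (l \<circ> r) \<longlonglongrightarrow> \<mu> \<and>
    \<mu> \<in> dir_normal_cone (F x) \<Omega> (jacobian F (at x) *v u) \<and>
    gradient (\<lambda>y. lagrangian f F y a \<mu>) x = 0 \<and>
    (twice_diff_real_at f x \<and> twice_diff_vec_at F x \<longrightarrow>
      0 \<le> u \<bullet> (hessian (\<lambda>y. lagrangian f F y a \<mu>) x *v u))"
  proof (rule limit_multiplier[OF f F \<Omega>(1) x t X _ _ _ s(1) _ C l_def K])
    show "X k = x + t k *\<^sub>R ((X k - x) /\<^sub>R t k)" for k using t(1)[of k] by simp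
    show "y k \<in> \<Omega>" for k using st' by blast
    show "(\<lambda>k. (F (X k) - y k) /\<^sub>R t k) \<longlonglongrightarrow> 0"
    proof (rule Lim_null_comparison[OF always_eventually d], rule allI)
      fix k
      have "norm (F (X k) - y k) \<le> dist1 (X k) + dist2 (X k)"
        using norm_triangle_ineq[of "block J (F (X k) - y k)" "block (- J) (F (X k) - y k)"] st'
        by (simp add: block_complement)
      then show "norm ((F (X k) - y k) /\<^sub>R t k) \<le> (dist1 (X k) + dist2 (X k)) / t k"
        using t(1)[of k] by (simp add: divide_inverse mult.commute mult_left_mono)
    qed
    show "(\<lambda>k. s k / (t k)\<^sup>2) \<longlonglongrightarrow> 0"
    proof (rule Lim_null_comparison[OF always_eventually t(2)], rule allI)
      fix k
      have "s k / (t k)\<^sup>2 \<le> (t k) ^ 3 / (t k)\<^sup>2" using s(2) by (intro divide_right_mono) auto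
      also have "\<dots> = t k" by (simp add: power2_eq_square power3_eq_cube)
      finally show "norm (s k / (t k)\<^sup>2) \<le> t k" using s(1)[of k] by simp
    qed
    show "(\<lambda>k. a *\<^sub>R gradient f (X k) + l k v* jacobian F (at (X k))) \<longlonglongrightarrow> 0"
      by (rule Lim_null_comparison[OF always_eventually st(2)]) (use st' in \<open>simp add: l_def\<close>)
    show "a * f x \<le> a * f (X k) +
      C' * (norm (block J (F (X k) - y k)) + norm (block (- J) (F (X k) - y k)))" for k
      using lower[of k] st' by simp
  qed
  then show ?thesis by (simp add: l_def comp_def)
qed

end

section \<open>The subregular case\<close>

lemma nearest_point:
  fixes x z :: "'a::euclidean_space"
  assumes "closed S" "x \<in> S"
  obtains p where "p \<in> S" "norm (p - z) = infdist z S" "norm (p - x) \<le> 2 * norm (z - x)"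
proof -
  obtain p where p: "p \<in> S" "infdist z S = dist z p"
    using infdist_attains_inf[OF assms(1)] assms(2) by blast
  have "dist z p \<le> norm (z - x)" using infdist_le[OF assms(2), of z] p(2) by (simp add: dist_norm)
  then have "norm (p - x) \<le> 2 * norm (z - x)"
    using norm_triangle_ineq[of "p - z" "z - x"] by (simp add: dist_norm norm_minus_commute)
  with p that show thesis by (simp add: dist_norm norm_minus_commute)
qed

context split_problem
begin

text \<open>Project onto the feasible set: minimality compares the projection with \<open>x\<close>,
  the Lipschitz bound of \<open>f\<close> leads back to the original point, and subregularity bounds
  the distance between the two. The constant is \<open>B * \<kappa>\<close>.\<close>

lemma exact_penalty:
  assumes min: "local_minimizer f F \<Omega> x"
    and sub: "dir_metric_subregular (constraint_map F \<Omega>) u x 0"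
  shows "\<exists>C\<ge>0. \<exists>e>0. \<forall>t h. 0 < t \<and> t \<le> e \<and> norm h \<le> e \<longrightarrow>
    f x \<le> f (x + t *\<^sub>R (u + h)) + C * (dist1 (x + t *\<^sub>R (u + h)) + dist2 (x + t *\<^sub>R (u + h)))"
proof -
  define S where "S = {z. F z \<in> \<Omega>}"
  have x: "x \<in> S" using min by (simp add: S_def local_minimizer_def)
  obtain \<epsilon> where \<epsilon>: "\<epsilon> > 0" "\<And>z. z \<in> ball x \<epsilon> \<Longrightarrow> z \<in> S \<Longrightarrow> f x \<le> f z"
    using min unfolding local_minimizer_def S_def by blast
  obtain \<rho> \<delta> \<kappa> where sub': "\<rho> > 0" "\<delta> > 0" "\<kappa> > 0"
    "\<And>z. z \<in> dir_nbhd \<rho> \<delta> u \<Longrightarrow> infdist (x + z) S \<le> \<kappa> * infdist (F (x + z)) \<Omega>"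
    using sub unfolding dir_metric_subregular_constraint_map[OF x S_def] by blast
  obtain r B where B: "r > 0" "B > 0" "\<And>y z. y \<in> ball x r \<Longrightarrow> z \<in> ball x r \<Longrightarrow> norm (f y - f z) \<le> B * norm (y - z)"
    using cont_diff_real_lipschitz_near[OF f, of x] by blast
  obtain e0 where e0: "e0 > 0" "\<And>t h. 0 < t \<Longrightarrow> t \<le> e0 \<Longrightarrow> norm h \<le> e0 \<Longrightarrow> t *\<^sub>R (u + h) \<in> dir_nbhd \<rho> \<delta> u"
    using dir_nbhd_contains[OF sub'(1,2), of u] by blast
  \<comment> \<open>This puts \<open>z\<close> within a quarter of both radii, so its projection, at
    most twice as far from \<open>x\<close>, stays in the Lipschitz ball and in the ball of
    minimality.\<close>
  define b where "b = min r \<epsilon> / 4 / (norm u + 1)"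
  have nu: "norm u + 1 > 0" by (simp add: add_nonneg_pos)
  have b: "b > 0" using B(1) \<epsilon>(1) nu by (simp add: b_def)
  define e where "e = min (min e0 1) b"
  have e: "e > 0" "e \<le> e0" "e \<le> 1" "e \<le> b" using e0(1) b by (simp_all add: e_def)
  have "f x \<le> f z + (B * \<kappa>) * (dist1 z + dist2 z)"
    if t: "0 < t" "t \<le> e" and h: "norm h \<le> e" and z: "z = x + t *\<^sub>R (u + h)" for t h z
  proof -
    have "norm (u + h) \<le> norm u + 1" using h e(3) norm_triangle_ineq[of u h] by linarith
    then have "t * norm (u + h) \<le> b * (norm u + 1)"
      using t e(4) b by (intro mult_mono) auto
    also have "\<dots> = min r \<epsilon> / 4" unfolding b_def using nu by (intro nonzero_eq_divide_eq[THEN iffD1]) auto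
    finally have zx: "norm (z - x) \<le> min r \<epsilon> / 4" using t(1) by (simp add: z)
    obtain p where p: "p \<in> S" "norm (p - z) = infdist z S" "norm (p - x) \<le> 2 * norm (z - x)"
      using nearest_point[OF closed_feasible(1) x[unfolded S_def], of z] unfolding S_def by blast
    have m: "min r \<epsilon> > 0" using B(1) \<epsilon>(1) by simp
    have "norm (p - x) < min r \<epsilon>" "norm (z - x) < min r \<epsilon>" using p(3) zx m by linarith+
    then have in_ball: "p \<in> ball x r" "p \<in> ball x \<epsilon>" "z \<in> ball x r"
      by (simp_all add: dist_norm norm_minus_commute)
    have "infdist z S \<le> \<kappa> * infdist (F z) \<Omega>"
      using sub'(4)[OF e0(2)[OF t(1) order_trans[OF t(2) e(2)] order_trans[OF h e(2)]]] by (simp add: z)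
    also have "\<dots> \<le> \<kappa> * (dist1 z + dist2 z)" using sub'(3) infdist_le_dist by (intro mult_left_mono) auto
    finally have "B * norm (p - z) \<le> B * (\<kappa> * (dist1 z + dist2 z))"
      using B(2) by (simp add: p(2))
    moreover have "f p - f z \<le> B * norm (p - z)" using B(3)[OF in_ball(1,3)] by simp
    ultimately show ?thesis using \<epsilon>(2)[OF in_ball(2) p(1)] by (simp add: mult.assoc)
  qed
  moreover have "0 \<le> B * \<kappa>" using B(2) sub'(3) by simp
  ultimately show ?thesis using e(1) by blast
qed

text \<open>Tangency makes the infeasibility of \<open>x + t k *\<^sub>R u\<close> of order o(t),
  and criticality bounds the increase of \<open>f\<close> by o(t). So the merit there exceeds its
  local lower bound \<open>f x\<close> by at most \<open>t k * e k\<close> with \<open>e\<close>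
  tending to 0.\<close>

lemma multiplier_if_subregular:
  assumes min: "local_minimizer f F \<Omega> x" and u: "u \<in> critical_cone f F \<Omega> x"
    and sub: "dir_metric_subregular (constraint_map F \<Omega>) u x 0"
  shows "\<exists>\<mu>. \<mu> \<in> dir_normal_cone (F x) \<Omega> (jacobian F (at x) *v u) \<and>
    gradient (\<lambda>y. lagrangian f F y 1 \<mu>) x = 0 \<and>
    (twice_diff_real_at f x \<and> twice_diff_vec_at F x \<longrightarrow>
      0 \<le> u \<bullet> (hessian (\<lambda>y. lagrangian f F y 1 \<mu>) x *v u))"
proof -
  have x: "F x \<in> \<Omega>" using min by (simp add: local_minimizer_def)
  obtain C' e0 where pen: "C' \<ge> 0" "e0 > 0" "\<And>t h. 0 < t \<Longrightarrow> t \<le> e0 \<Longrightarrow> norm h \<le> e0 \<Longrightarrow>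
    f x \<le> f (x + t *\<^sub>R (u + h)) + C' * (dist1 (x + t *\<^sub>R (u + h)) + dist2 (x + t *\<^sub>R (u + h)))"
    using exact_penalty[OF min sub] by blast
  have "jacobian F (at x) *v u \<in> contingent_cone (F x) \<Omega>"
    using u by (simp add: critical_cone_def linearized_cone_def)
  then obtain t v where t: "\<And>k. 0 < t k" "t \<longlonglongrightarrow> 0" and v: "v \<longlonglongrightarrow> jacobian F (at x) *v u"
    and feas: "\<And>k::nat. F x + t k *\<^sub>R v k \<in> \<Omega>"
    unfolding contingent_cone_def by blast
  define c where "c k = x + t k *\<^sub>R u" for k
  define D where "D k = infdist (F (c k)) \<Omega>" for k
  have D0: "0 \<le> D k" for k by (simp add: D_def infdist_nonneg)
  have dF: "(F has_derivative (\<lambda>h. jacobian F (at x) *v h)) (at x)"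
    using diff(2) jacobian_works by blast
  have "(\<lambda>k. (F (c k) - F x) /\<^sub>R t k - v k) \<longlonglongrightarrow> jacobian F (at x) *v u - jacobian F (at x) *v u"
    unfolding c_def by (intro tendsto_diff hadamard_derivative[OF dF t tendsto_const] v)
  then have lim_v: "(\<lambda>k. norm ((F (c k) - F x) /\<^sub>R t k - v k)) \<longlonglongrightarrow> 0"
    by (simp add: tendsto_norm_zero)
  have lim_D: "(\<lambda>k. D k / t k) \<longlonglongrightarrow> 0"
  proof (rule Lim_null_comparison[OF always_eventually lim_v], rule allI)
    fix k
    have "D k \<le> norm (F (c k) - (F x + t k *\<^sub>R v k))"
      unfolding D_def using infdist_le[OF feas[of k]] by (simp add: dist_norm)
    then have "D k / t k \<le> norm (F (c k) - (F x + t k *\<^sub>R v k)) / t k"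
      using t(1)[of k] by (intro divide_right_mono) auto
    also have "\<dots> = norm ((F (c k) - (F x + t k *\<^sub>R v k)) /\<^sub>R t k)"
      using t(1)[of k] by (simp add: divide_inverse mult.commute)
    also have "(F (c k) - (F x + t k *\<^sub>R v k)) /\<^sub>R t k = (F (c k) - F x) /\<^sub>R t k - v k"
      using t(1)[of k] by (simp add: scaleR_diff_right scaleR_add_right)
    finally show "norm (D k / t k) \<le> norm ((F (c k) - F x) /\<^sub>R t k - v k)"
      using D0[of k] t(1)[of k] by simp
  qed
  define q where "q k = (f (c k) - f x) / t k" for k
  have "q \<longlonglongrightarrow> gradient f x \<bullet> u"
    using hadamard_derivative[OF has_derivative_gradient[OF diff(1)] t tendsto_const, of x u]
    by (simp add: q_def[abs_def] c_def divide_inverse mult.commute)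
  then have "(\<lambda>k. max 0 (q k)) \<longlonglongrightarrow> max 0 (gradient f x \<bullet> u)" by (intro tendsto_intros)
  moreover have "gradient f x \<bullet> u \<le> 0" using u by (simp add: critical_cone_def)
  ultimately have lim_q: "(\<lambda>k. max 0 (q k)) \<longlonglongrightarrow> 0" by simp
  \<comment> \<open>One unit above the exactness constant: the surplus separates \<open>C'\<close>
    from \<open>C\<close> and also bounds the block distances at the minimizer.\<close>
  define C where "C = C' + 1"
  have C: "0 \<le> C" "C' < C" using pen(1) by (simp_all add: C_def)
  \<comment> \<open>The increase of \<open>f\<close>, counted only if positive, plus both block
    penalties with smoothing t^3, all divided by t. The final \<open>t k\<close> makes the sum, and
    hence the radius below, strictly positive.\<close>
  define e where "e k = max 0 (q k) + 2 * C * (D k / t k + (t k)\<^sup>2) + t k" for k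
  have "e \<longlonglongrightarrow> 0 + 2 * C * (0 + 0\<^sup>2) + 0"
    unfolding e_def[abs_def] by (intro tendsto_intros lim_q lim_D t(2))
  then have e_lim: "e \<longlonglongrightarrow> 0" by simp
  have e_pos: "0 < e k" for k
  proof -
    have "0 \<le> 2 * C * (D k / t k + (t k)\<^sup>2)" using C(1) D0[of k] t(1)[of k] by simp
    then show ?thesis using t(1)[of k] max.cobounded1[of 0 "q k"] unfolding e_def by linarith
  qed
  have sqrt_lim: "(\<lambda>k. sqrt (e k)) \<longlonglongrightarrow> 0" using tendsto_real_sqrt[OF e_lim] by simp
  have "\<forall>\<^sub>F k in sequentially. sqrt (e k) < e0 \<and> t k < e0"
    using order_tendstoD(2)[OF sqrt_lim pen(2)] order_tendstoD(2)[OF t(2) pen(2)] by eventually_elim simp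
  then obtain N where N: "\<And>k. k \<ge> N \<Longrightarrow> sqrt (e k) \<le> e0 \<and> t k \<le> e0"
    unfolding eventually_sequentially by (meson less_imp_le)

  have step: "\<exists>z y. norm (z - c k) \<le> t k * sqrt (e k) \<and>
    almost_stationary 1 C C ((t k) ^ 3) (4 * sqrt (e k)) z y \<and>
    dist1 z + dist2 z \<le> t k * e k \<and> 1 * f x \<le> 1 * f z + C' * (dist1 z + dist2 z)" if k: "k \<ge> N" for k
  proof -
    \<comment> \<open>Both \<rho>/t and (t e)/\<rho> equal sqrt e: the first preserves the
      direction, the second makes the point almost stationary.\<close>
    define \<rho> where "\<rho> = t k * sqrt (e k)"
    have \<rho>: "\<rho> > 0" using t(1) e_pos by (simp add: \<rho>_def)
    have s: "0 < (t k) ^ 3" using t(1) by simp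
    have low: "f x \<le> f z + C' * (dist1 z + dist2 z)" if z: "z \<in> cball (c k) \<rho>" for z
    proof -
      define h where "h = (z - c k) /\<^sub>R t k"
      have "norm h \<le> inverse (t k) * \<rho>"
        using z t(1)[of k] by (simp add: h_def dist_norm norm_minus_commute)
      also have "\<dots> = sqrt (e k)" using t(1)[of k] by (simp add: \<rho>_def)
      finally have h: "norm h \<le> e0" using N[OF k] by linarith
      have "z = x + t k *\<^sub>R (u + h)"
        using t(1)[of k] by (simp add: h_def c_def scaleR_add_right)
      then show ?thesis using pen(3)[OF t(1) _ h, of k] N[OF k] by simp
    qed
    have d: "C' * (dist1 z + dist2 z) + (dist1 z + dist2 z) = C * dist1 z + C * dist2 z" for z
      by (simp add: C_def algebra_simps)
    have "merit 1 C C ((t k) ^ 3) (c k) \<le> f (c k) + C * (dist1 (c k) + (t k) ^ 3) + C * (dist2 (c k) + (t k) ^ 3)"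
      using merit_le[OF C(1) C(1) less_imp_le[OF s], of 1 "c k"] by simp
    also have "\<dots> \<le> f (c k) + C * (D k + (t k) ^ 3) + C * (D k + (t k) ^ 3)"
      using dist_le[of "c k"] C(1) by (intro add_mono mult_left_mono) (auto simp: D_def)
    also have "f (c k) = f x + t k * q k" using t(1)[of k] by (simp add: q_def)
    also have "f x + t k * q k + C * (D k + (t k) ^ 3) + C * (D k + (t k) ^ 3)
      = f x + t k * (q k + 2 * C * (D k / t k + (t k)\<^sup>2))"
      using t(1)[of k] by (simp add: algebra_simps power2_eq_square power3_eq_cube)
    also have "\<dots> \<le> f x + t k * e k"
      using t(1)[of k] by (intro add_left_mono mult_left_mono) (auto simp: e_def)
    finally have base: "merit 1 C C ((t k) ^ 3) (c k) \<le> f x + t k * e k" .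
    have lower: "f x \<le> merit 1 C C ((t k) ^ 3) z" if z: "z \<in> cball (c k) \<rho>" for z
      using low[OF z] d[of z] merit_ge[OF C(1) C(1), of 1 z "(t k) ^ 3"] dist_nonneg[of z] by linarith
    obtain z y where z: "norm (z - c k) \<le> \<rho> / 2" "almost_stationary 1 C C ((t k) ^ 3) (4 * (t k * e k) / \<rho>) z y"
      "merit 1 C C ((t k) ^ 3) z \<le> merit 1 C C ((t k) ^ 3) (c k)"
      using almost_stationary_exists[OF s C(1) C(1) \<rho> base lower] by blast
    have zc: "norm (z - c k) \<le> \<rho>" using z(1) \<rho> by linarith
    then have z_in: "z \<in> cball (c k) \<rho>" by (simp add: dist_norm norm_minus_commute)
    have "4 * (t k * e k) / \<rho> = 4 * (e k / sqrt (e k))" using t(1)[of k] by (simp add: \<rho>_def)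
    also have "\<dots> = 4 * sqrt (e k)" using e_pos[of k] by (simp only: real_div_sqrt less_imp_le)
    finally have st: "almost_stationary 1 C C ((t k) ^ 3) (4 * sqrt (e k)) z y" using z(2) by simp
    \<comment> \<open>The merit exceeds \<open>f x\<close> by at most \<open>t k * e k\<close>,
      while exactness with \<open>C'\<close> leaves the block distances as surplus.\<close>
    have "dist1 z + dist2 z \<le> t k * e k"
      using low[OF z_in] d[of z] merit_ge[OF C(1) C(1), of 1 z "(t k) ^ 3"] z(3) base by linarith
    then show ?thesis using zc st low[OF z_in] unfolding \<rho>_def by auto
  qed
  define M where "M k = k + N" for k
  have "\<forall>k. \<exists>z y. norm (z - c (M k)) \<le> t (M k) * sqrt (e (M k)) \<and>
    almost_stationary 1 C C ((t (M k)) ^ 3) (4 * sqrt (e (M k))) z y \<and>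
    dist1 z + dist2 z \<le> t (M k) * e (M k) \<and> 1 * f x \<le> 1 * f z + C' * (dist1 z + dist2 z)"
    using step by (simp add: M_def)
  from choice[OF this] obtain X where "\<forall>k. \<exists>y. norm (X k - c (M k)) \<le> t (M k) * sqrt (e (M k)) \<and>
    almost_stationary 1 C C ((t (M k)) ^ 3) (4 * sqrt (e (M k))) (X k) y \<and>
    dist1 (X k) + dist2 (X k) \<le> t (M k) * e (M k) \<and> 1 * f x \<le> 1 * f (X k) + C' * (dist1 (X k) + dist2 (X k))" ..
  from choice[OF this] obtain Y where XY: "\<And>k. norm (X k - c (M k)) \<le> t (M k) * sqrt (e (M k))"
    "\<And>k. almost_stationary 1 C C ((t (M k)) ^ 3) (4 * sqrt (e (M k))) (X k) (Y k)"
    "\<And>k. dist1 (X k) + dist2 (X k) \<le> t (M k) * e (M k)"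
    "\<And>k. 1 * f x \<le> 1 * f (X k) + C' * (dist1 (X k) + dist2 (X k))" by blast
  have sub_lim: "Z \<longlonglongrightarrow> z \<Longrightarrow> (\<lambda>k. Z (M k)) \<longlonglongrightarrow> z" for Z :: "nat \<Rightarrow> real" and z
    unfolding M_def by (rule LIMSEQ_ignore_initial_segment)
  have "(\<lambda>k. (X k - x) /\<^sub>R t (M k) - u) \<longlonglongrightarrow> 0"
  proof (rule Lim_null_comparison[OF always_eventually sub_lim[OF sqrt_lim]], rule allI)
    fix k
    have "(X k - x) /\<^sub>R t (M k) - u = (X k - c (M k)) /\<^sub>R t (M k)"
      using t(1)[of "M k"] by (simp add: c_def scaleR_diff_right scaleR_add_right)
    then have "norm ((X k - x) /\<^sub>R t (M k) - u) = inverse (t (M k)) * norm (X k - c (M k))"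
      using t(1)[of "M k"] by simp
    also have "\<dots> \<le> inverse (t (M k)) * (t (M k) * sqrt (e (M k)))"
      using XY(1)[of k] t(1)[of "M k"] by (intro mult_left_mono) auto
    also have "\<dots> = sqrt (e (M k))" using t(1)[of "M k"] by simp
    finally show "norm ((X k - x) /\<^sub>R t (M k) - u) \<le> sqrt (e (M k))" .
  qed
  then have X_lim: "(\<lambda>k. (X k - x) /\<^sub>R t (M k)) \<longlonglongrightarrow> u" by (rule LIM_zero_cancel)
  have d_lim: "(\<lambda>k. (dist1 (X k) + dist2 (X k)) / t (M k)) \<longlonglongrightarrow> 0"
  proof (rule Lim_null_comparison[OF always_eventually sub_lim[OF e_lim]], rule allI)
    fix k
    have "(dist1 (X k) + dist2 (X k)) / t (M k) \<le> e (M k)"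
      using XY(3)[of k] t(1)[of "M k"] by (simp add: divide_le_eq mult.commute)
    then show "norm ((dist1 (X k) + dist2 (X k)) / t (M k)) \<le> e (M k)"
      using dist_nonneg[of "X k"] t(1)[of "M k"] by simp
  qed
  have eps_lim: "(\<lambda>k. 4 * sqrt (e (M k))) \<longlonglongrightarrow> 0"
    using tendsto_mult_right_zero[OF sub_lim[OF sqrt_lim], of 4] by simp
  have s: "0 < (t (M k)) ^ 3" "(t (M k)) ^ 3 \<le> (t (M k)) ^ 3" for k using t(1) by simp_all
  show ?thesis
    using limit_of_almost_stationary[OF x t(1) sub_lim[OF t(2)] X_lim XY(2) eps_lim d_lim s pen(1) C(2) C(2) XY(4)]
    by blast
qed

end

section \<open>The case without subregularity\<close>

context split_problem
begin

lemma dist1_lipschitz: "dist1 y \<le> dist1 z + norm (F y - F z)"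
proof -
  have "dist1 y \<le> dist1 z + dist (block J (F y)) (block J (F z))"
    unfolding dist1_def by (rule infdist_triangle)
  also have "\<dots> \<le> dist1 z + norm (F y - F z)"
    using norm_block_le[of J "F y - F z"] by (simp add: dist_norm block_diff)
  finally show ?thesis .
qed

lemma almost_stationary_mono:
  "almost_stationary a C\<^sub>1 C\<^sub>2 s \<epsilon> z y \<Longrightarrow> \<epsilon> \<le> \<epsilon>' \<Longrightarrow> almost_stationary a C\<^sub>1 C\<^sub>2 s \<epsilon>' z y"
  unfolding almost_stationary_def using order_trans by blast

text \<open>The second block is penalized exactly, so that its residual at the minimizer is of the order
  of the smoothing parameter. Hence the first residual stays away from zero relative to that
  parameter, which keeps the first multiplier block from vanishing in the limit.\<close>

lemma infeasible_step:
  assumes p: "dist2 p = 0" "0 < dist1 p"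
    and R: "R = infdist p {z. F z \<in> \<Omega>}" "0 < R"
    and g: "g = dist1 p / R" "g < 1" "16 * \<kappa> * sqrt g \<le> 1"
    and pos: "0 < \<kappa>" "0 < B" "0 < \<tau>"
    and lip: "\<And>y z. y \<in> cball p R \<Longrightarrow> z \<in> cball p R \<Longrightarrow> norm (F y - F z) \<le> B * norm (y - z)"
    and sub: "\<And>z. z \<in> cball p (R * sqrt g) \<Longrightarrow> infdist z {z. dist2 z = 0} \<le> \<kappa> * dist2 z"
  shows "\<exists>s z y. 0 < s \<and> s \<le> \<tau> \<and> norm (z - p) \<le> R * sqrt g \<and>
    almost_stationary 0 1 (B * \<kappa> + 2) s (8 * sqrt g) z y \<and>
    dist1 z + dist2 z \<le> 2 * dist1 p \<and> s \<le> dist1 z"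
proof -
  define q where "q = dist1 p"
  have q: "q > 0" using p by (simp add: q_def)
  have gpos: "0 < g" using g(1) p(2) R(2) by simp
  have qg: "q = g * R" using g(1) R(2) by (simp add: q_def)
  \<comment> \<open>Geometric mean of \<open>q\<close> and \<open>R\<close>: both
    \<open>q / \<rho>\<close> and \<open>\<rho> / R\<close> equal \<open>sqrt g\<close>. Since
    \<rho> < R, the ball contains no feasible point.\<close>
  define \<rho> where "\<rho> = R * sqrt g"
  have \<rho>: "0 < \<rho>" using R(2) gpos by (simp add: \<rho>_def)
  have "R * sqrt g < R * 1" using R(2) g(2) gpos by (intro mult_strict_left_mono) auto
  then have \<rho>R: "\<rho> < R" by (simp add: \<rho>_def)
  have q\<rho>: "q = sqrt g * \<rho>" using gpos by (simp add: qg \<rho>_def)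
  \<comment> \<open>Moving onto the second constraint set changes the first residual by at most
    \<open>B * \<kappa> * dist2 z\<close>; one further unit pays for the proximal term, and the
    other leaves \<open>dist2 z \<le> K * s\<close>.\<close>
  define K where "K = B * \<kappa> + 2"
  have B\<kappa>: "0 < B * \<kappa>" using pos by simp
  have K: "2 \<le> K" using B\<kappa> by (simp add: K_def)

  \<comment> \<open>A positive lower bound of the first residual on the second constraint set must
    be known before \<open>s\<close> is chosen, as \<open>s\<close> has to be small compared with
    it; compactness provides it.\<close>
  define A where "A = {z. dist2 z = 0} \<inter> cball p \<rho>"
  have "compact A" unfolding A_def by (intro closed_Int_compact closed_feasible compact_cball)
  moreover have pA: "p \<in> A" using p \<rho> by (simp add: A_def)
  ultimately obtain w where w: "w \<in> A" "\<And>z. z \<in> A \<Longrightarrow> dist1 w \<le> dist1 z"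
    using continuous_attains_inf[OF _ _ continuous_dist(1), of A] by blast
  have \<mu>: "dist1 w > 0"
  proof (rule ccontr)
    assume "\<not> dist1 w > 0"
    then have "F w \<in> \<Omega>" using w(1) dist_nonneg(1)[of w] by (simp add: feasible_iff A_def)
    then have "R \<le> dist p w" unfolding R(1) by (intro infdist_le) simp
    then show False using w(1) \<rho>R by (simp add: A_def)
  qed

  \<comment> \<open>The bound by \<open>q\<close> keeps the smoothed merit at \<open>p\<close> at
    most \<open>2 * q\<close>; the last one makes \<open>B * \<kappa> * K * s + s\<close> at most
    half of the minimal residual \<open>dist1 w\<close>.\<close>
  define s where "s = min \<tau> (min (q / (1 + K)) (dist1 w / (2 * (B * \<kappa> * K + 1))))"
  have BK: "0 < B * \<kappa> * K + 1" using B\<kappa> K by (simp add: add_pos_pos)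
  have s: "0 < s" "s \<le> \<tau>" "s \<le> q / (1 + K)" "s \<le> dist1 w / (2 * (B * \<kappa> * K + 1))"
    using pos(3) q K \<mu> BK by (simp_all add: s_def)
  have s1: "s + K * s \<le> q" using s(3) K by (simp add: le_divide_eq algebra_simps)
  have "s * (2 * (B * \<kappa> * K + 1)) \<le> dist1 w"
    using s(4) BK by (subst (asm) le_divide_eq) simp
  then have s2: "2 * (B * \<kappa> * (K * s)) + 2 * s \<le> dist1 w" by (simp add: algebra_simps)

  have K0: "0 \<le> (1::real)" "0 \<le> K" using K by simp_all
  have base: "merit 0 1 K s p \<le> 0 + 2 * q"
    using merit_le[OF K0 less_imp_le[OF s(1)], of 0 p] s1 p(1) by (simp add: q_def)
  have ge: "dist1 z + K * dist2 z \<le> merit 0 1 K s z" for z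
    using merit_ge[OF K0, of 0 z s] by simp
  have lower: "0 \<le> merit 0 1 K s z" for z
    using ge[of z] dist_nonneg[of z] K by (smt (verit) mult_nonneg_nonneg)
  obtain z y where z: "norm (z - p) \<le> \<rho> / 2" "almost_stationary 0 1 K s (4 * (2 * q) / \<rho>) z y"
    "merit 0 1 K s z \<le> merit 0 1 K s p"
    and comp: "\<And>z'. z' \<in> cball p \<rho> \<Longrightarrow> merit 0 1 K s z + 4 * (2 * q) / \<rho>\<^sup>2 * (norm (z - p))\<^sup>2
       \<le> merit 0 1 K s z' + 4 * (2 * q) / \<rho>\<^sup>2 * (norm (z' - p))\<^sup>2"
    using almost_stationary_exists[OF s(1) K0 \<rho> base lower] by blast
  have "4 * (2 * q) / \<rho> = 8 * sqrt g" using \<rho> by (simp add: q\<rho>)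
  then have st: "almost_stationary 0 1 K s (8 * sqrt g) z y" using z(2) by simp
  have d: "dist1 z + K * dist2 z \<le> 2 * q" using ge[of z] z(3) base by linarith
  moreover have "1 * dist2 z \<le> K * dist2 z" using K dist_nonneg(2) by (intro mult_right_mono) auto
  ultimately have d_sum: "dist1 z + dist2 z \<le> 2 * q" by linarith
  have z_p: "norm (z - p) \<le> \<rho>" using z(1) \<rho> by linarith
  have z_in: "z \<in> cball p \<rho>" using z_p by (simp add: dist_norm norm_minus_commute)

  \<comment> \<open>The projection of \<open>z\<close> onto the second constraint set is the
    competitor that shows exactness of the second penalty.\<close>
  obtain p' where p': "dist2 p' = 0" "norm (p' - z) = infdist z {z. dist2 z = 0}"
    using nearest_point[OF closed_feasible(2), of p z] p(1) by blast
  have p'z: "norm (p' - z) \<le> \<kappa> * dist2 z"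
    using sub[of z] z_in p'(2) by (simp add: \<rho>_def)
  also have "\<dots> \<le> \<kappa> * (2 * q)" using d_sum dist_nonneg(1)[of z] pos(1) by (intro mult_left_mono) auto
  \<comment> \<open>The factor 16 is fitted to the change of the proximal term estimated below; here
    it keeps \<open>p'\<close> inside the ball.\<close>
  also have "\<dots> = (16 * \<kappa> * sqrt g) * (\<rho> / 8)" by (simp add: q\<rho>)
  also have "\<dots> \<le> 1 * (\<rho> / 8)" using g(3) \<rho> by (intro mult_right_mono) auto
  finally have "norm (p' - z) \<le> \<rho> / 8" by simp
  then have p'_p: "norm (p' - p) \<le> \<rho>" using norm_triangle_ineq[of "p' - z" "z - p"] z(1) \<rho> by simp
  then have p'_in: "p' \<in> cball p \<rho>" by (simp add: dist_norm norm_minus_commute)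

  have F_near: "norm (F p' - F z) \<le> B * \<kappa> * dist2 z"
  proof -
    have "norm (F p' - F z) \<le> B * norm (p' - z)" using p'_in z_in \<rho>R by (intro lip) auto
    also have "\<dots> \<le> B * (\<kappa> * dist2 z)" using p'z pos(2) by (intro mult_left_mono) auto
    finally show ?thesis by (simp add: mult.assoc)
  qed
  define \<sigma> where "\<sigma> = 4 * (2 * q) / \<rho>\<^sup>2"
  have \<sigma>: "0 \<le> \<sigma>" using q by (simp add: \<sigma>_def)
  have "\<sigma> * (norm (p' - p))\<^sup>2 - \<sigma> * (norm (z - p))\<^sup>2 \<le> dist2 z"
  proof -
    have "(norm (p' - p))\<^sup>2 - (norm (z - p))\<^sup>2 = (norm (p' - p) - norm (z - p)) * (norm (p' - p) + norm (z - p))"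
      by (simp add: power2_eq_square algebra_simps)
    also have "\<dots> \<le> (\<kappa> * dist2 z) * (2 * \<rho>)"
    proof (rule mult_mono)
      show "norm (p' - p) - norm (z - p) \<le> \<kappa> * dist2 z"
        using norm_triangle_ineq2[of "p' - p" "z - p"] p'z by simp
      show "norm (p' - p) + norm (z - p) \<le> 2 * \<rho>" using p'_p z_p by simp
      show "0 \<le> \<kappa> * dist2 z" using pos(1) dist_nonneg by simp
    qed simp
    finally have "\<sigma> * ((norm (p' - p))\<^sup>2 - (norm (z - p))\<^sup>2) \<le> \<sigma> * ((\<kappa> * dist2 z) * (2 * \<rho>))"
      using \<sigma> by (rule mult_left_mono)
    also have "\<dots> = (16 * \<kappa> * sqrt g) * dist2 z"
      using \<rho> by (simp add: \<sigma>_def q\<rho> power2_eq_square)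
    also have "\<dots> \<le> 1 * dist2 z" using g(3) dist_nonneg by (intro mult_right_mono) auto
    finally show ?thesis by (simp add: right_diff_distrib)
  qed
  moreover have "merit 0 1 K s p' \<le> soft_abs s (dist1 z) + B * \<kappa> * dist2 z + K * s"
  proof -
    have "soft_abs s (dist1 p') \<le> soft_abs s (dist1 z) + B * \<kappa> * dist2 z"
      using dist_nonneg dist1_lipschitz[of p' z] F_near B\<kappa>
      by (intro soft_abs_mono) auto
    moreover have "K * soft_abs s (dist2 p') \<le> K * (0 + s)"
      unfolding p'(1) using s(1) K0(2) by (intro mult_left_mono soft_abs_le) auto
    ultimately show ?thesis by (simp add: merit_def)
  qed
  moreover have "soft_abs s (dist1 z) + K * dist2 z \<le> merit 0 1 K s z"
    using soft_abs_ge[of "dist2 z" s] K0(2) by (simp add: merit_def mult_left_mono)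
  ultimately have "K * dist2 z \<le> B * \<kappa> * dist2 z + K * s + dist2 z"
    using comp[OF p'_in] unfolding \<sigma>_def[symmetric] by linarith
  then have d2: "dist2 z \<le> K * s" by (simp add: K_def algebra_simps)
  have "p' \<in> A" using p'(1) p'_in by (simp add: A_def)
  then have "dist1 w \<le> dist1 z + B * \<kappa> * dist2 z"
    using w(2)[of p'] dist1_lipschitz[of p' z] F_near by linarith
  also have "\<dots> \<le> dist1 z + B * \<kappa> * (K * s)" using d2 B\<kappa> by (intro add_left_mono mult_left_mono) auto
  finally have "s \<le> dist1 z"
    using s2 s(1) mult_pos_pos[OF B\<kappa> mult_pos_pos[of K s]] K by linarith
  with s(1,2) z_p st d_sum show ?thesis unfolding K_def \<rho>_def q_def by blast
qed

text \<open>Subregularity of the second block makes the shift of a violating point onto its solution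
  set at most \<open>\<kappa> * D k\<close>. After the shift the first residual is therefore still
  negligible relative to the distance from the feasible set.\<close>

lemma abnormal_multiplier_if_not_subregular:
  assumes x: "F x \<in> \<Omega>"
    and sub: "dir_metric_subregular (constraint_map (block (- J) \<circ> F) \<Omega>\<^sub>2) u x 0"
    and not_sub: "\<not> dir_metric_subregular (constraint_map F \<Omega>) u x 0"
  shows "\<exists>\<mu>. \<mu> \<in> dir_normal_cone (F x) \<Omega> (jacobian F (at x) *v u) \<and>
    gradient (\<lambda>y. lagrangian f F y 0 \<mu>) x = 0 \<and> block J \<mu> \<noteq> 0 \<and>
    (twice_diff_real_at f x \<and> twice_diff_vec_at F x \<longrightarrow>
      0 \<le> u \<bullet> (hessian (\<lambda>y. lagrangian f F y 0 \<mu>) x *v u))"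
proof -
  define S where "S = {z. F z \<in> \<Omega>}"
  define S2 where "S2 = {z. dist2 z = 0}"
  have xS: "x \<in> S" using x by (simp add: S_def)
  have xS2: "x \<in> S2" using x by (simp add: S2_def feasible_iff)
  have closed: "closed S" "closed S2" unfolding S_def S2_def by (fact closed_feasible)+
  have S2: "S2 = {z. (block (- J) \<circ> F) z \<in> \<Omega>\<^sub>2}"
    using in_closed_iff_infdist_zero[OF \<Omega>2(1) blocks_nonempty(2)] by (simp add: S2_def dist2_def)
  obtain \<rho> \<delta> \<kappa> where sub': "\<rho> > 0" "\<delta> > 0" "\<kappa> > 0"
    "\<And>z. z \<in> dir_nbhd \<rho> \<delta> u \<Longrightarrow> infdist (x + z) S2 \<le> \<kappa> * dist2 (x + z)"
    using sub unfolding dir_metric_subregular_constraint_map[OF xS2 S2] by (auto simp: dist2_def)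
  obtain e0 where e0: "e0 > 0" "\<And>t h. 0 < t \<Longrightarrow> t \<le> e0 \<Longrightarrow> norm h \<le> e0 \<Longrightarrow> t *\<^sub>R (u + h) \<in> dir_nbhd \<rho> \<delta> u"
    using dir_nbhd_contains[OF sub'(1,2), of u] by blast
  obtain r B where B: "r > 0" "B > 0" "\<And>y z. y \<in> ball x r \<Longrightarrow> z \<in> ball x r \<Longrightarrow> norm (F y - F z) \<le> B * norm (y - z)"
    using cont_diff_vec_lipschitz_near[OF F, of x] by blast
  define K where "K = B * \<kappa> + 2"
  have K: "0 < K" using B(2) sub'(3) by (simp add: K_def add_pos_pos)

  \<comment> \<open>One sequence serves as radius, as angular width and, inverted, as the violated
    subregularity constant.\<close>
  define i where "i k = 1 / real (Suc k)" for k
  have i: "0 < i k" for k by (simp add: i_def)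
  have i_lim: "i \<longlonglongrightarrow> 0" unfolding i_def[abs_def] by (rule LIMSEQ_Suc[OF lim_inverse_n'])
  have "\<exists>z. z \<in> dir_nbhd (i k) (i k) u \<and> real (Suc k) * infdist (F (x + z)) \<Omega> < infdist (x + z) S" for k
    using not_sub i[of k] unfolding dir_metric_subregular_constraint_map[OF xS S_def]
    by (metis not_less of_nat_0_less_iff zero_less_Suc)
  then obtain z where z: "\<And>k. z k \<in> dir_nbhd (i k) (i k) u"
    "\<And>k. real (Suc k) * infdist (F (x + z k)) \<Omega> < infdist (x + z k) S" by metis
  define w where "w k = norm (z k)" for k
  define D where "D k = infdist (F (x + z k)) \<Omega>" for k
  have D0: "0 \<le> D k" for k by (simp add: D_def infdist_nonneg)
  have z0: "z k \<noteq> 0" for k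
  proof
    assume "z k = 0"
    then show False using z(2)[of k] D0[of k] xS by (simp add: D_def) (smt (verit) mult_nonneg_nonneg of_nat_0_le_iff)
  qed
  have w0: "0 < w k" for k using z0 by (simp add: w_def)
  have w_i: "w k \<le> i k" for k using z(1)[of k] by (simp add: w_def dir_nbhd_def)
  have dS: "infdist (x + z k) S \<le> w k" for k
    using infdist_le[OF xS, of "x + z k"] by (simp add: dist_norm w_def)
  have D_w: "D k \<le> w k * i k" for k
    using z(2)[of k] dS[of k] by (simp add: D_def[symmetric] i_def pos_le_divide_eq mult.commute)
  obtain t where t: "\<And>k. 0 < t k" "t \<longlonglongrightarrow> 0" "(\<lambda>k. z k /\<^sub>R t k) \<longlonglongrightarrow> u"
    using dir_nbhd_sequence[OF z(1)[unfolded i_def] z0] by blast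
  define a where "a k = w k / t k" for k
  have a0: "0 < a k" for k using w0 t(1) by (simp add: a_def)
  have "(\<lambda>k. norm (z k /\<^sub>R t k)) \<longlonglongrightarrow> norm u" using t(3) by (rule tendsto_norm)
  moreover have "norm (z k /\<^sub>R t k) = a k" for k
    using t(1)[of k] by (simp add: a_def w_def divide_inverse mult.commute)
  ultimately have a_lim: "a \<longlonglongrightarrow> norm u" by simp

  \<comment> \<open>Bound for the first residual of the shifted point relative to its distance from
    the feasible set: the residual is at most \<open>1 + B * \<kappa>\<close> times
    \<open>D k\<close>, and half of the rate \<open>Suc k\<close> survives the shift.\<close>
  define G where "G k = 2 * (1 + B * \<kappa>) * i k" for k
  have G0: "0 < G k" for k using i B(2) sub'(3) by (simp add: G_def add_pos_pos)
  have "G \<longlonglongrightarrow> 2 * (1 + B * \<kappa>) * 0" unfolding G_def[abs_def] by (intro tendsto_intros i_lim)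
  then have G_lim: "G \<longlonglongrightarrow> 0" by simp
  have sG_lim: "(\<lambda>k. sqrt (G k)) \<longlonglongrightarrow> 0" using tendsto_real_sqrt[OF G_lim] by simp
  \<comment> \<open>Directional error of points in the final ball, divided by \<open>t k\<close>:
    the error of \<open>z k\<close>, the shift, and the radius, in which the distance from the
    feasible set is at most \<open>2 * w k\<close>.\<close>
  define E where "E k = norm (z k /\<^sub>R t k - u) + \<kappa> * (a k * i k) + 2 * a k * sqrt (G k)" for k
  have "E \<longlonglongrightarrow> norm (u - u) + \<kappa> * (norm u * 0) + 2 * norm u * 0"
    unfolding E_def[abs_def] by (intro tendsto_intros t(3) a_lim i_lim sG_lim)
  then have E_lim: "E \<longlonglongrightarrow> 0" by simp
  have sG16: "(\<lambda>k. 16 * \<kappa> * sqrt (G k)) \<longlonglongrightarrow> 0" using tendsto_mult_right_zero[OF sG_lim] .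

  have "\<forall>\<^sub>F k in sequentially. i k < min (min \<rho> \<delta>) (min (r / 4) (1 / (2 * \<kappa>))) \<and> G k < 1 \<and>
      16 * \<kappa> * sqrt (G k) < 1 \<and> t k < e0 \<and> E k < e0"
    using sub'(1-3) B(1) e0(1)
    by (intro eventually_conj order_tendstoD(2)[OF i_lim] order_tendstoD(2)[OF G_lim]
        order_tendstoD(2)[OF sG16] order_tendstoD(2)[OF t(2)] order_tendstoD(2)[OF E_lim]) auto
  then obtain N where N: "\<And>k. k \<ge> N \<Longrightarrow> i k < \<rho> \<and> i k < \<delta> \<and> i k < r / 4 \<and> i k < 1 / (2 * \<kappa>) \<and> G k < 1 \<and>
      16 * \<kappa> * sqrt (G k) < 1 \<and> t k < e0 \<and> E k < e0"
    unfolding eventually_sequentially by (metis min_less_iff_conj)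

  have step: "\<exists>s X y. 0 < s \<and> s \<le> (t k) ^ 3 \<and> norm ((X - x) /\<^sub>R t k - u) \<le> E k \<and>
    almost_stationary 0 1 K s (8 * sqrt (G k)) X y \<and> dist1 X + dist2 X \<le> 4 * (G k * w k) \<and> s \<le> dist1 X"
    if k: "k \<ge> N" for k
  proof -
    note Nk = N[OF k]
    obtain p where p: "p \<in> S2" "norm (p - (x + z k)) = infdist (x + z k) S2"
      "norm (p - x) \<le> 2 * norm (x + z k - x)"
      using nearest_point[OF closed(2) xS2] by blast
    have p_w: "norm (p - x) \<le> 2 * w k" using p(3) by (simp add: w_def)
    have "z k \<in> dir_nbhd \<rho> \<delta> u"
      using z(1) dir_nbhd_mono[of "i k" \<rho> "i k" \<delta> u] Nk by (meson less_imp_le subsetD)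
    then have "norm (p - (x + z k)) \<le> \<kappa> * dist2 (x + z k)" using sub'(4) p(2) by simp
    also have "\<dots> \<le> \<kappa> * D k" using dist_le(2) sub'(3) by (simp add: D_def)
    finally have p_near: "norm (p - (x + z k)) \<le> \<kappa> * D k" .
    define R where "R = infdist p S"
    \<comment> \<open>For such \<open>k\<close>, subtracting \<open>\<kappa>\<close> from the rate
      \<open>Suc k\<close> leaves at least half of it.\<close>
    have ki: "2 * \<kappa> \<le> real (Suc k)"
    proof -
      have "i k * (2 * \<kappa>) < 1" using Nk sub'(3) by (simp add: less_divide_eq)
      then show ?thesis by (simp add: i_def divide_less_eq)
    qed
    have "real (Suc k) * D k < infdist (x + z k) S" using z(2) by (simp add: D_def)
    also have "\<dots> \<le> R + norm (p - (x + z k))"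
      unfolding R_def using infdist_triangle[of "x + z k" S p] by (simp add: dist_norm norm_minus_commute)
    finally have R_gt: "(real (Suc k) - \<kappa>) * D k < R" using p_near by (simp add: left_diff_distrib)
    have "(real (Suc k) / 2) * D k \<le> (real (Suc k) - \<kappa>) * D k"
      using ki D0 by (intro mult_right_mono) auto
    then have R_D: "real (Suc k) / 2 * D k < R" using R_gt by linarith
    have "0 \<le> real (Suc k) / 2 * D k" using D0 by simp
    then have R0: "0 < R" using R_D by linarith
    have R_w: "R \<le> 2 * w k"
      using infdist_le[OF xS, of p] p_w by (simp add: R_def dist_norm)
    have w_r: "4 * w k < r" using w_i[of k] Nk by simp
    have in_ball: "y \<in> ball x r" if "y \<in> cball p R" for y
    proof -
      have "norm (y - x) \<le> norm (y - p) + norm (p - x)" using norm_triangle_ineq[of "y - p" "p - x"] by simp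
      also have "\<dots> < r" using that R_w p_w w_r by (simp add: dist_norm norm_minus_commute)
      finally show ?thesis by (simp add: dist_norm norm_minus_commute)
    qed
    have xz: "x + z k \<in> ball x r" proof -
      have "w k < r" using w_r w0[of k] by linarith
      then show ?thesis by (simp add: dist_norm w_def)
    qed
    have p_ball: "p \<in> ball x r" using in_ball[of p] R0 by simp
    have "dist1 p \<le> dist1 (x + z k) + norm (F p - F (x + z k))" by (rule dist1_lipschitz)
    also have "\<dots> \<le> D k + B * norm (p - (x + z k))"
      using dist_le(1)[of "x + z k"] B(3)[OF p_ball xz] by (simp add: D_def add_mono)
    also have "\<dots> \<le> D k + B * (\<kappa> * D k)" using p_near B(2) by (intro add_left_mono mult_left_mono) auto
    also have "\<dots> = (1 + B * \<kappa>) * D k" by (simp add: algebra_simps)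
    also have "D k \<le> 2 * i k * R"
      using R_D by (simp add: i_def field_simps)
    finally have "dist1 p \<le> (1 + B * \<kappa>) * (2 * i k * R)"
      using B(2) sub'(3) by (simp add: mult_left_mono)
    then have p_G: "dist1 p \<le> G k * R" by (simp add: G_def mult_ac)
    define g where "g = dist1 p / R"
    have g: "g \<le> G k" using p_G R0 by (simp add: g_def divide_le_eq)
    have sg: "sqrt g \<le> sqrt (G k)" using g by simp
    have p1: "0 < dist1 p"
    proof (rule ccontr)
      assume "\<not> 0 < dist1 p"
      then have "p \<in> S" using dist_nonneg(1)[of p] p(1) by (simp add: S_def S2_def feasible_iff)
      then show False using R0 by (simp add: R_def)
    qed
    \<comment> \<open>The estimate covers the whole ball and not only the minimizer, because
      subregularity of the second block is applied at arbitrary points of it.\<close>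
    have dir: "norm ((y - x) /\<^sub>R t k - u) \<le> E k" if y: "norm (y - p) \<le> R * sqrt g" for y
    proof -
      have "norm (y - p) \<le> (2 * w k) * sqrt (G k)"
        using y mult_mono[OF R_w sg] w0[of k] by (simp add: g_def R0 dist_nonneg less_imp_le)
      moreover have "\<kappa> * D k \<le> \<kappa> * (w k * i k)" using D_w sub'(3) by (intro mult_left_mono) auto
      ultimately have "norm (y - (x + z k)) \<le> \<kappa> * (w k * i k) + (2 * w k) * sqrt (G k)"
        using norm_diff_triangle_le[OF order_refl p_near, of y] by linarith
      then have "norm (y - (x + z k)) / t k \<le> (\<kappa> * (w k * i k) + (2 * w k) * sqrt (G k)) / t k"
        using t(1)[of k] by (intro divide_right_mono) auto
      also have "\<dots> = \<kappa> * (a k * i k) + 2 * a k * sqrt (G k)"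
        by (simp add: a_def add_divide_distrib)
      finally have 1: "norm (y - (x + z k)) / t k \<le> \<kappa> * (a k * i k) + 2 * a k * sqrt (G k)" .
      have "(y - x) /\<^sub>R t k - u = (y - (x + z k)) /\<^sub>R t k + (z k /\<^sub>R t k - u)"
        by (simp add: scaleR_diff_right scaleR_add_right)
      then have "norm ((y - x) /\<^sub>R t k - u) \<le> norm ((y - (x + z k)) /\<^sub>R t k) + norm (z k /\<^sub>R t k - u)"
        using norm_triangle_ineq by metis
      also have "norm ((y - (x + z k)) /\<^sub>R t k) = norm (y - (x + z k)) / t k"
        using t(1)[of k] by (simp add: divide_inverse mult.commute)
      finally show ?thesis using 1 by (simp add: E_def)
    qed
    have "\<exists>s X y. 0 < s \<and> s \<le> (t k) ^ 3 \<and> norm (X - p) \<le> R * sqrt g \<and>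
      almost_stationary 0 1 (B * \<kappa> + 2) s (8 * sqrt g) X y \<and>
      dist1 X + dist2 X \<le> 2 * dist1 p \<and> s \<le> dist1 X"
    proof (rule infeasible_step[OF _ p1 R_def[unfolded S_def] R0 g_def _ _ sub'(3) B(2)])
      show "dist2 p = 0" using p(1) by (simp add: S2_def)
      show "g < 1" using g Nk by linarith
      have "16 * \<kappa> * sqrt g \<le> 16 * \<kappa> * sqrt (G k)" using sg sub'(3) by (intro mult_left_mono) auto
      then show "16 * \<kappa> * sqrt g \<le> 1" using Nk by linarith
      show "0 < (t k) ^ 3" using t(1) by simp
      show "norm (F y - F y') \<le> B * norm (y - y')" if "y \<in> cball p R" "y' \<in> cball p R" for y y'
        using B(3) in_ball that by blast
      show "infdist y {z. dist2 z = 0} \<le> \<kappa> * dist2 y" if "y \<in> cball p (R * sqrt g)" for y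
      proof -
        define h where "h = (y - x) /\<^sub>R t k - u"
        have "norm h \<le> E k" unfolding h_def using that by (intro dir) (simp add: dist_norm norm_minus_commute)
        then have "norm h \<le> e0" "t k \<le> e0" using Nk by linarith+
        from sub'(4)[OF e0(2)[OF t(1) this(2,1)]] show ?thesis
          using t(1)[of k] by (simp add: h_def S2_def)
      qed
    qed
    then obtain s X y where X: "0 < s" "s \<le> (t k) ^ 3" "norm (X - p) \<le> R * sqrt g"
      "almost_stationary 0 1 K s (8 * sqrt g) X y" "dist1 X + dist2 X \<le> 2 * dist1 p" "s \<le> dist1 X"
      unfolding K_def by blast
    have "dist1 p \<le> G k * (2 * w k)"
      using p_G mult_left_mono[OF R_w less_imp_le[OF G0]] by (rule order_trans)
    then have "dist1 X + dist2 X \<le> 4 * (G k * w k)" using X(5) by simp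
    moreover have "almost_stationary 0 1 K s (8 * sqrt (G k)) X y"
      using sg by (intro almost_stationary_mono[OF X(4)]) simp
    ultimately show ?thesis using X(1,2,6) dir[OF X(3)] by blast
  qed
  define M where "M k = k + N" for k
  have "\<forall>k. \<exists>s X y. 0 < s \<and> s \<le> (t (M k)) ^ 3 \<and> norm ((X - x) /\<^sub>R t (M k) - u) \<le> E (M k) \<and>
    almost_stationary 0 1 K s (8 * sqrt (G (M k))) X y \<and>
    dist1 X + dist2 X \<le> 4 * (G (M k) * w (M k)) \<and> s \<le> dist1 X"
    using step by (simp add: M_def)
  from choice[OF this] obtain s where "\<forall>k. \<exists>X y. 0 < s k \<and> s k \<le> (t (M k)) ^ 3 \<and>
    norm ((X - x) /\<^sub>R t (M k) - u) \<le> E (M k) \<and> almost_stationary 0 1 K (s k) (8 * sqrt (G (M k))) X y \<and>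
    dist1 X + dist2 X \<le> 4 * (G (M k) * w (M k)) \<and> s k \<le> dist1 X" ..
  from choice[OF this] obtain X where "\<forall>k. \<exists>y. 0 < s k \<and> s k \<le> (t (M k)) ^ 3 \<and>
    norm ((X k - x) /\<^sub>R t (M k) - u) \<le> E (M k) \<and> almost_stationary 0 1 K (s k) (8 * sqrt (G (M k))) (X k) y \<and>
    dist1 (X k) + dist2 (X k) \<le> 4 * (G (M k) * w (M k)) \<and> s k \<le> dist1 (X k)" ..
  from choice[OF this] obtain Y where XY: "\<And>k. 0 < s k" "\<And>k. s k \<le> (t (M k)) ^ 3"
    "\<And>k. norm ((X k - x) /\<^sub>R t (M k) - u) \<le> E (M k)"
    "\<And>k. almost_stationary 0 1 K (s k) (8 * sqrt (G (M k))) (X k) (Y k)"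
    "\<And>k. dist1 (X k) + dist2 (X k) \<le> 4 * (G (M k) * w (M k))" "\<And>k. s k \<le> dist1 (X k)" by blast
  have sub_lim: "Z \<longlonglongrightarrow> z \<Longrightarrow> (\<lambda>k. Z (M k)) \<longlonglongrightarrow> z" for Z :: "nat \<Rightarrow> real" and z
    unfolding M_def by (rule LIMSEQ_ignore_initial_segment)
  have "(\<lambda>k. (X k - x) /\<^sub>R t (M k) - u) \<longlonglongrightarrow> 0"
    using XY(3) by (intro Lim_null_comparison[OF always_eventually sub_lim[OF E_lim]]) blast
  then have X_lim: "(\<lambda>k. (X k - x) /\<^sub>R t (M k)) \<longlonglongrightarrow> u" by (rule LIM_zero_cancel)
  have "(\<lambda>k. 4 * (G k * a k)) \<longlonglongrightarrow> 4 * (0 * norm u)" by (intro tendsto_intros G_lim a_lim)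
  then have Ga_lim: "(\<lambda>k. 4 * (G k * a k)) \<longlonglongrightarrow> 0" by simp
  have d_lim: "(\<lambda>k. (dist1 (X k) + dist2 (X k)) / t (M k)) \<longlonglongrightarrow> 0"
  proof (rule Lim_null_comparison[OF always_eventually sub_lim[OF Ga_lim]], rule allI)
    fix k
    have "(dist1 (X k) + dist2 (X k)) / t (M k) \<le> 4 * (G (M k) * w (M k)) / t (M k)"
      using XY(5) t(1)[of "M k"] by (intro divide_right_mono) auto
    then show "norm ((dist1 (X k) + dist2 (X k)) / t (M k)) \<le> 4 * (G (M k) * a (M k))"
      using dist_nonneg[of "X k"] t(1)[of "M k"] by (simp add: a_def)
  qed
  have eps_lim: "(\<lambda>k. 8 * sqrt (G (M k))) \<longlonglongrightarrow> 0"
    using tendsto_mult_right_zero[OF sub_lim[OF sG_lim], of 8] by simp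
  \<comment> \<open>Without the objective, exactness reads 0 \<le> 0, and the gap condition only
    asks for positive penalty constants.\<close>
  have low: "0 * f x \<le> 0 * f (X k) + 0 * (dist1 (X k) + dist2 (X k))" for k by simp
  obtain r \<mu> where \<mu>: "(\<lambda>k. penalty_normal J 1 K (s (r k)) (F (X (r k)) - Y (r k))) \<longlonglongrightarrow> \<mu>"
    "\<mu> \<in> dir_normal_cone (F x) \<Omega> (jacobian F (at x) *v u)"
    "gradient (\<lambda>y. lagrangian f F y 0 \<mu>) x = 0"
    "twice_diff_real_at f x \<and> twice_diff_vec_at F x \<longrightarrow>
      0 \<le> u \<bullet> (hessian (\<lambda>y. lagrangian f F y 0 \<mu>) x *v u)"
    using limit_of_almost_stationary[OF x t(1) sub_lim[OF t(2)] X_lim XY(4) eps_lim d_lim XY(1,2) order_refl zero_less_one K low]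
    by blast
  \<comment> \<open>Since \<open>s k \<le> dist1 (X k)\<close>, the smoothed residual is at most
    twice the residual; the normalized first block cannot shrink below one half.\<close>
  have "1 / 2 \<le> norm (block J (penalty_normal J 1 K (s k) (F (X k) - Y k)))" for k
  proof -
    have n: "norm (block J (F (X k) - Y k)) = dist1 (X k)"
      using XY(4)[of k] unfolding almost_stationary_def by blast
    have d: "0 < dist1 (X k)" using XY(1,6)[of k] by linarith
    have "soft_abs (s k) (dist1 (X k)) \<le> 2 * dist1 (X k)"
      using soft_abs_le[of "dist1 (X k)" "s k"] XY(1,6)[of k] d by linarith
    then show ?thesis
      using d soft_abs_pos[OF XY(1), of k "dist1 (X k)"]
      by (simp add: block_penalty_normal n le_divide_eq)
  qed
  moreover have "(\<lambda>k. norm (block J (penalty_normal J 1 K (s (r k)) (F (X (r k)) - Y (r k))))) \<longlonglongrightarrow> norm (block J \<mu>)"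
    by (intro tendsto_norm bounded_linear.tendsto[OF bounded_linear_block] \<mu>(1))
  ultimately have "1 / 2 \<le> norm (block J \<mu>)" by (intro LIMSEQ_le_const) auto
  then have "block J \<mu> \<noteq> 0" by auto
  with \<mu>(2-4) show ?thesis by blast
qed

end

theorem theorem3p3:
  fixes f :: "real^'n \<Rightarrow> real" and F :: "real^'n \<Rightarrow> real^'m"
    and \<Omega> \<Omega>\<^sub>1 \<Omega>\<^sub>2 :: "(real^'m) set" and J :: "'m set"
    and x u :: "real^'n"
  assumes "cont_diff_real f"
    and "cont_diff_vec F"
    and "finite_union_polyhedra \<Omega>"
    and "local_minimizer f F \<Omega> x"
    and "u \<in> critical_cone f F \<Omega> x"
    and "splitting F \<Omega> x u J \<Omega>\<^sub>1 \<Omega>\<^sub>2"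
  shows "(\<exists>l\<^sub>0\<ge>0.
            multipliers f F \<Omega> J l\<^sub>0 x u \<noteq> {} \<and>
            (twice_diff_real_at f x \<and> twice_diff_vec_at F x \<longrightarrow>
              (\<exists>l\<in>multipliers f F \<Omega> J l\<^sub>0 x u.
                 u \<bullet> (hessian (\<lambda>y. lagrangian f F y l\<^sub>0 l) x *v u) \<ge> 0))) \<and>
         (dir_metric_subregular (constraint_map F \<Omega>) u x 0 \<longrightarrow>
            multipliers f F \<Omega> J 1 x u \<noteq> {} \<and>
            (twice_diff_real_at f x \<and> twice_diff_vec_at F x \<longrightarrow>
              (\<exists>l\<in>multipliers f F \<Omega> J 1 x u.
                 u \<bullet> (hessian (\<lambda>y. lagrangian f F y 1 l) x *v u) \<ge> 0)))"
proof -
  have x: "F x \<in> \<Omega>" using assms(4) by (simp add: local_minimizer_def)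
  interpret split_problem f F \<Omega> \<Omega>\<^sub>1 \<Omega>\<^sub>2 J
    using assms x unfolding splitting_def
    by unfold_locales (blast intro: finite_union_polyhedra_closed)+
  have regular: "multipliers f F \<Omega> J 1 x u \<noteq> {} \<and>
      (twice_diff_real_at f x \<and> twice_diff_vec_at F x \<longrightarrow>
        (\<exists>l\<in>multipliers f F \<Omega> J 1 x u.
           u \<bullet> (hessian (\<lambda>y. lagrangian f F y 1 l) x *v u) \<ge> 0))"
    if sub: "dir_metric_subregular (constraint_map F \<Omega>) u x 0"
  proof -
    obtain l where l: "l \<in> dir_normal_cone (F x) \<Omega> (jacobian F (at x) *v u)"
      "gradient (\<lambda>y. lagrangian f F y 1 l) x = 0"
      "twice_diff_real_at f x \<and> twice_diff_vec_at F x \<longrightarrow>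
        0 \<le> u \<bullet> (hessian (\<lambda>y. lagrangian f F y 1 l) x *v u)"
      using multiplier_if_subregular[OF assms(4,5) sub] by blast
    have "1 + norm (block J l) \<noteq> 0" using norm_ge_zero[of "block J l"] by linarith
    then have "l \<in> multipliers f F \<Omega> J 1 x u" using l(1,2) by (simp add: multipliers_def)
    with l(3) show ?thesis by blast
  qed
  \<comment> \<open>Under subregularity \<open>l\<^sub>0 = 1\<close> serves both claims. Otherwise
    the second claim is vacuous and \<open>l\<^sub>0 = 0\<close> serves the first, nontriviality
    coming from the first block.\<close>
  show ?thesis
  proof (cases "dir_metric_subregular (constraint_map F \<Omega>) u x 0")
    case True
    then show ?thesis using regular zero_le_one by blast
  next
    case False
    have sub2: "dir_metric_subregular (constraint_map (block (- J) \<circ> F) \<Omega>\<^sub>2) u x 0"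
      using assms(6) by (simp add: splitting_def)
    obtain l where l: "l \<in> dir_normal_cone (F x) \<Omega> (jacobian F (at x) *v u)"
      "gradient (\<lambda>y. lagrangian f F y 0 l) x = 0" "block J l \<noteq> 0"
      "twice_diff_real_at f x \<and> twice_diff_vec_at F x \<longrightarrow>
        0 \<le> u \<bullet> (hessian (\<lambda>y. lagrangian f F y 0 l) x *v u)"
      using abnormal_multiplier_if_not_subregular[OF x sub2 False] by blast
    then have "l \<in> multipliers f F \<Omega> J 0 x u" by (simp add: multipliers_def)
    with l(4) have "multipliers f F \<Omega> J 0 x u \<noteq> {} \<and>
        (twice_diff_real_at f x \<and> twice_diff_vec_at F x \<longrightarrow>
          (\<exists>l\<in>multipliers f F \<Omega> J 0 x u.
             u \<bullet> (hessian (\<lambda>y. lagrangian f F y 0 l) x *v u) \<ge> 0))" by blast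
    with False show ?thesis by blast
  qed
qed

end
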